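(* Let $j\in\{0,1,2,3\}$ and $F=\widetilde V(\tau+\xi_j)$. Up to isomorphism, there are four $\Gamma$-equivariant structures on the $S'$-module $F\otimes k^2$.
   Context: Let $k$ be an algebraically closed field of characteristic $\neq2,3$; $\alpha_1,\alpha_2,\alpha_3\in k\setminus\{0,1,-1\}$ with $\alpha_1+\alpha_2+\alpha_3+\alpha_1\alpha_2\alpha_3=0$; fix $a,b,c,\mathbf i\in k$ with $a^2=\alpha_1,b^2=\alpha_2,c^2=\alpha_3,\mathbf i^2=-1$. $S$ is the graded algebra generated by $x_0,\dots,x_3$ (degree 1) with relations $x_0x_i-x_ix_0=\alpha_i(x_jx_k+x_kx_j)$, $x_0x_i+x_ix_0=x_jx_k-x_kx_j$ for all cyclic permutations $(i,j,k)$ of $(1,2,3)$. $q_0=1$, $q_1=\begin{pmatrix}\mathbf i&0\\0&-\mathbf i\end{pmatrix}$, $q_2=\begin{pmatrix}0&\mathbf i\\\mathbf i&0\end{pmatrix}$, $q_3=\begin{pmatrix}0&-1\\1&0\end{pmatrix}$ in $M_2(k)$. $\Gamma=\{g_0=1,g_1,g_2,g_3\}\cong(\mathbb Z/2)^2$ acts on $S$ by graded algebra automorphisms: for $j=1,2,3$, $g_j$ fixes $x_0$ and $x_j$ and changes the sign of the other two generators. It acts on $M_2(k)$ by $g_j(m)=q_jmq_j^{-1}$, and diagonally on $S'=S\otimes M_2(k)$ (graded with $M_2(k)$ in degree 0). $V(\tau+\xi_j)=k^2$ is the simple left $S$-module on which $(x_0,x_1,x_2,x_3)$ acts as $j=0$: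 $(1,q_1,q_2,q_3)$; $j=1$: $(bc\,q_1,-\mathbf i,-\mathbf ib\,q_3,-c\,q_2)$; $j=2$: $(ac\,q_2,-a\,q_3,-\mathbf i,-\mathbf ic\,q_1)$; $j=3$: $(ab\,q_3,-\mathbf ia\,q_2,-b\,q_1,-\mathbf i)$. (The symbols $\tau+\xi_j$ are here only labels.) $\widetilde V(\tau+\xi_j)=V(\tau+\xi_j)\otimes k[t]$ is the graded $S$-module with $V(\tau+\xi_j)\otimes t^m$ in degree $m$ and $s(v\otimes t^m)=(sv)\otimes t^{m+n}$ for $s\in S_n$. $F\otimes k^2$ is the graded $S'$-module with $k^2$ the standard $M_2(k)$-module. A $\Gamma$-equivariant structure on a graded left $S'$-module $M$ is a degree-preserving linear action $\Gamma\times M\to M$, $(g,m)\mapsto m^g$, with $(xm)^g=g(x)m^g$ for all $x\in S'$, $m\in M$, $g\in\Gamma$. Isomorphisms of equivariant modules are graded $S'$-module isomorphisms commuting with $\Gamma$. *)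

theory Defs
  imports
    "HOL-Analysis.Determinants"
    "HOL-Computational_Algebra.Polynomial"
    "HOL-Library.Poly_Mapping"
    "HOL-Algebra.QuotRing"
    "HOL-Algebra.Module"
    "HOL-Algebra.Group_Action"
begin

text \<open>
  Vector spaces and algebras over the field \<^typ>\<open>'k\<close> are records of type
  \<^typ>\<open>('k, 'v) module\<close> (theory \<^theory>\<open>HOL-Algebra.Module\<close>). The fields \<^const>\<open>mult\<close> and \<^const>\<open>one\<close> of a
  mere vector space have no meaning and are set to \<^const>\<open>undefined\<close>.

  Elements of quotients are cosets. \<open>rep\<close> chooses a representative; wherever it is used, the
  result does not depend on the choice.
\<close>

definition rep :: "'a set \<Rightarrow> 'a"
  where "rep X = (SOME p. p \<in> X)"


section \<open>Tensor products\<close>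

text \<open>
  \<open>V \<otimes> W\<close> is the free vector space on \<open>V \<times> W\<close>, i.e. the finitely supported functions
  on \<open>carrier V \<times> carrier W\<close>, modulo the span of the bilinearity relations.
\<close>

definition fscale :: "'k::field \<Rightarrow> ('x \<Rightarrow>\<^sub>0 'k) \<Rightarrow> ('x \<Rightarrow>\<^sub>0 'k)"
  where "fscale c p = Poly_Mapping.map ((*) c) p"

abbreviation gen :: "'x \<Rightarrow> ('x \<Rightarrow>\<^sub>0 'k::field)"
  where "gen x \<equiv> Poly_Mapping.single x 1"

definition bilinear_rels ::
    "('k::field, 'v) module \<Rightarrow> ('k, 'w) module \<Rightarrow> ('v \<times> 'w \<Rightarrow>\<^sub>0 'k) set"
  where "bilinear_rels V W =
      {gen (v \<oplus>\<^bsub>V\<^esub> v', w) - gen (v, w) - gen (v', w) | v v' w.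
         v \<in> carrier V \<and> v' \<in> carrier V \<and> w \<in> carrier W}
    \<union> {gen (v, w \<oplus>\<^bsub>W\<^esub> w') - gen (v, w) - gen (v, w') | v w w'.
         v \<in> carrier V \<and> w \<in> carrier W \<and> w' \<in> carrier W}
    \<union> {gen (c \<odot>\<^bsub>V\<^esub> v, w) - fscale c (gen (v, w)) | c v w. v \<in> carrier V \<and> w \<in> carrier W}
    \<union> {gen (v, c \<odot>\<^bsub>W\<^esub> w) - fscale c (gen (v, w)) | c v w. v \<in> carrier V \<and> w \<in> carrier W}"

definition tensor_class ::
    "('k::field, 'v) module \<Rightarrow> ('k, 'w) module \<Rightarrow> ('v \<times> 'w \<Rightarrow>\<^sub>0 'k) \<Rightarrow> ('v \<times> 'w \<Rightarrow>\<^sub>0 'k) set"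
  where "tensor_class V W p = {p'. p' - p \<in> Modules.module.span fscale (bilinear_rels V W)}"

definition tensor_space ::
    "('k::field, 'v) module \<Rightarrow> ('k, 'w) module \<Rightarrow> ('k, ('v \<times> 'w \<Rightarrow>\<^sub>0 'k) set) module"
  where "tensor_space V W =
    \<lparr>carrier = {tensor_class V W p | p. Poly_Mapping.keys p \<subseteq> carrier V \<times> carrier W},
     monoid.mult = undefined, one = undefined,
     ring.zero = tensor_class V W 0,
     add = (\<lambda>X Y. tensor_class V W (rep X + rep Y)),
     module.smult = (\<lambda>c X. tensor_class V W (fscale c (rep X)))\<rparr>"

definition pure_tensor ::
    "('k::field, 'v) module \<Rightarrow> ('k, 'w) module \<Rightarrow> 'v \<Rightarrow> 'w \<Rightarrow> ('v \<times> 'w \<Rightarrow>\<^sub>0 'k) set"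
  where "pure_tensor V W v w = tensor_class V W (gen (v, w))"

text \<open>
  The linear map \<open>V \<otimes> W \<rightarrow> U\<close> with \<open>v \<otimes> w \<mapsto> f v w\<close>, for a bilinear \<open>f\<close>.
\<close>

definition tensor_lift ::
    "('k::field, 'u) module \<Rightarrow> ('v \<Rightarrow> 'w \<Rightarrow> 'u) \<Rightarrow> ('v \<times> 'w \<Rightarrow>\<^sub>0 'k) set \<Rightarrow> 'u"
  where "tensor_lift U f X =
    (\<Oplus>\<^bsub>U\<^esub>z\<in>Poly_Mapping.keys (rep X). Poly_Mapping.lookup (rep X) z \<odot>\<^bsub>U\<^esub> f (fst z) (snd z))"

text \<open>The tensor product of two algebras, with \<open>(x \<otimes> y) (x' \<otimes> y') = x x' \<otimes> y y'\<close>.\<close>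

definition tensor_algebra ::
    "('k::field, 'a) module \<Rightarrow> ('k, 'b) module \<Rightarrow> ('k, ('a \<times> 'b \<Rightarrow>\<^sub>0 'k) set) module"
  where "tensor_algebra A B = (tensor_space A B)
    \<lparr>monoid.mult := (\<lambda>X Y.
       tensor_lift (tensor_space A B)
         (\<lambda>x y. tensor_lift (tensor_space A B)
            (\<lambda>x' y'. pure_tensor A B (x \<otimes>\<^bsub>A\<^esub> x') (y \<otimes>\<^bsub>B\<^esub> y')) Y) X),
     one := pure_tensor A B \<one>\<^bsub>A\<^esub> \<one>\<^bsub>B\<^esub>\<rparr>"


section \<open>The algebra \<open>S\<close>\<close>

text \<open>
  The indices \<open>0, 1, 2, 3\<close>. They number the generators \<open>x\<^sub>0, \<dots>, x\<^sub>3\<close>, the elements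
  \<open>g\<^sub>0, \<dots>, g\<^sub>3\<close> of the group, and the four modules.
\<close>

datatype idx = I0 | I1 | I2 | I3

definition cyclic :: "(idx \<times> idx \<times> idx) set"
  where "cyclic = {(I1, I2, I3), (I2, I3, I1), (I3, I1, I2)}"

text \<open>
  Noncommutative monomials in the generators, as a monoid under concatenation. It is written
  additively so that the finitely supported functions on it, with the convolution product of
  \<^theory>\<open>HOL-Library.Poly_Mapping\<close>, form the free algebra.
\<close>

datatype monomial = Mon (letters: "idx list")

instantiation monomial :: monoid_add
begin

definition zero_monomial :: monomial
  where "0 = Mon []"

definition plus_monomial :: "monomial \<Rightarrow> monomial \<Rightarrow> monomial"
  where "u + v = Mon (letters u @ letters v)"

instance
  by standard (auto simp: zero_monomial_def plus_monomial_def)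

end

type_synonym 'k free_alg = "monomial \<Rightarrow>\<^sub>0 'k"

definition free_algebra :: "('k::field, 'k free_alg) module"
  where "free_algebra =
    \<lparr>carrier = UNIV, monoid.mult = (*), one = 1, ring.zero = 0, add = (+), module.smult = fscale\<rparr>"

definition xgen :: "idx \<Rightarrow> 'k::field free_alg"
  where "xgen i = gen (Mon [i])"

text \<open>Only the values of \<open>\<alpha>\<close> at \<^const>\<open>I1\<close>, \<^const>\<open>I2\<close> and \<^const>\<open>I3\<close> matter.\<close>

definition S_relations :: "(idx \<Rightarrow> 'k::field) \<Rightarrow> 'k free_alg set"
  where "S_relations \<alpha> =
      {(xgen I0 * xgen i - xgen i * xgen I0) - fscale (\<alpha> i) (xgen j * xgen k + xgen k * xgen j) | i j k. (i, j, k) \<in> cyclic}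
    \<union> {(xgen I0 * xgen i + xgen i * xgen I0) - (xgen j * xgen k - xgen k * xgen j) | i j k. (i, j, k) \<in> cyclic}"

definition S_ideal :: "(idx \<Rightarrow> 'k::field) \<Rightarrow> 'k free_alg set"
  where "S_ideal \<alpha> = Idl\<^bsub>free_algebra\<^esub> (S_relations \<alpha>)"

definition S_class :: "(idx \<Rightarrow> 'k::field) \<Rightarrow> 'k free_alg \<Rightarrow> 'k free_alg set"
  where "S_class \<alpha> p = S_ideal \<alpha> +>\<^bsub>free_algebra\<^esub> p"

definition S :: "(idx \<Rightarrow> 'k::field) \<Rightarrow> ('k, 'k free_alg set) module"
  where "S \<alpha> = ring.extend (free_algebra Quot S_ideal \<alpha>)
    (module.fields (\<lambda>c s. S_class \<alpha> (fscale c (rep s))))"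

text \<open>The component of degree \<open>n\<close> of an element of \<open>S\<close>.\<close>

definition free_component :: "nat \<Rightarrow> 'k::field free_alg \<Rightarrow> 'k free_alg"
  where "free_component n p =
    (\<Sum>w\<in>{w \<in> Poly_Mapping.keys p. length (letters w) = n}. Poly_Mapping.single w (Poly_Mapping.lookup p w))"

definition S_component :: "(idx \<Rightarrow> 'k::field) \<Rightarrow> nat \<Rightarrow> 'k free_alg set \<Rightarrow> 'k free_alg set"
  where "S_component \<alpha> n s = S_class \<alpha> (free_component n (rep s))"


section \<open>The matrices \<open>q\<^sub>j\<close> and the algebra \<open>S' = S \<otimes> M\<^sub>2(k)\<close>\<close>

fun q :: "'k::field \<Rightarrow> idx \<Rightarrow> 'k^2^2"
  where
    "q i I0 = mat 1"
  | "q i I1 = vector [vector [i, 0], vector [0, - i]]"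
  | "q i I2 = vector [vector [0, i], vector [i, 0]]"
  | "q i I3 = vector [vector [0, - 1], vector [1, 0]]"

definition mscale :: "'k::field \<Rightarrow> 'k^2^2 \<Rightarrow> 'k^2^2"
  where "mscale c m = (\<chi> r s. c * m $ r $ s)"

definition M2 :: "('k::field, 'k^2^2) module"
  where "M2 =
    \<lparr>carrier = UNIV, monoid.mult = (**), one = mat 1, ring.zero = 0, add = (+), module.smult = mscale\<rparr>"

definition S' :: "(idx \<Rightarrow> 'k::field) \<Rightarrow> ('k, ('k free_alg set \<times> ('k^2^2) \<Rightarrow>\<^sub>0 'k) set) module"
  where "S' \<alpha> = tensor_algebra (S \<alpha>) M2"


section \<open>The group \<open>\<Gamma>\<close> and its actions\<close>

fun klein_mult :: "idx \<Rightarrow> idx \<Rightarrow> idx"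
  where
    "klein_mult I0 h = h"
  | "klein_mult g I0 = g"
  | "klein_mult I1 I1 = I0" | "klein_mult I1 I2 = I3" | "klein_mult I1 I3 = I2"
  | "klein_mult I2 I1 = I3" | "klein_mult I2 I2 = I0" | "klein_mult I2 I3 = I1"
  | "klein_mult I3 I1 = I2" | "klein_mult I3 I2 = I1" | "klein_mult I3 I3 = I0"

definition \<Gamma> :: "idx monoid"
  where "\<Gamma> = \<lparr>carrier = UNIV, monoid.mult = klein_mult, one = I0\<rparr>"

definition gen_sign :: "idx \<Rightarrow> idx \<Rightarrow> 'k::field"
  where "gen_sign g i = (if g = I0 \<or> i = I0 \<or> i = g then 1 else - 1)"

definition free_\<Gamma> :: "idx \<Rightarrow> 'k::field free_alg \<Rightarrow> 'k free_alg"
  where "free_\<Gamma> g p = (\<Sum>w\<in>Poly_Mapping.keys p.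
    Poly_Mapping.single w (Poly_Mapping.lookup p w * prod_list (map (gen_sign g) (letters w))))"

definition S_\<Gamma> :: "(idx \<Rightarrow> 'k::field) \<Rightarrow> idx \<Rightarrow> 'k free_alg set \<Rightarrow> 'k free_alg set"
  where "S_\<Gamma> \<alpha> g s = S_class \<alpha> (free_\<Gamma> g (rep s))"

definition M2_\<Gamma> :: "'k::field \<Rightarrow> idx \<Rightarrow> 'k^2^2 \<Rightarrow> 'k^2^2"
  where "M2_\<Gamma> i g m = q i g ** m ** matrix_inv (q i g)"

definition S'_\<Gamma> :: "(idx \<Rightarrow> 'k::field) \<Rightarrow> 'k \<Rightarrow> idx \<Rightarrow>
    ('k free_alg set \<times> ('k^2^2) \<Rightarrow>\<^sub>0 'k) set \<Rightarrow> ('k free_alg set \<times> ('k^2^2) \<Rightarrow>\<^sub>0 'k) set"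
  where "S'_\<Gamma> \<alpha> i g = tensor_lift (S' \<alpha>) (\<lambda>s m. pure_tensor (S \<alpha>) M2 (S_\<Gamma> \<alpha> g s) (M2_\<Gamma> i g m))"


section \<open>The module \<open>V(\<tau> + \<xi>\<^sub>j)\<close>\<close>

definition k2 :: "('k::field, 'k^2) module"
  where "k2 =
    \<lparr>carrier = UNIV, monoid.mult = undefined, one = undefined, ring.zero = 0, add = (+), module.smult = (*s)\<rparr>"

fun V_gen :: "'k::field \<Rightarrow> 'k \<Rightarrow> 'k \<Rightarrow> 'k \<Rightarrow> idx \<Rightarrow> idx \<Rightarrow> 'k^2^2"
  where
    "V_gen a b c i I0 I0 = mat 1"
  | "V_gen a b c i I0 I1 = q i I1"
  | "V_gen a b c i I0 I2 = q i I2"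
  | "V_gen a b c i I0 I3 = q i I3"
  | "V_gen a b c i I1 I0 = mscale (b * c) (q i I1)"
  | "V_gen a b c i I1 I1 = mat (- i)"
  | "V_gen a b c i I1 I2 = mscale (- i * b) (q i I3)"
  | "V_gen a b c i I1 I3 = mscale (- c) (q i I2)"
  | "V_gen a b c i I2 I0 = mscale (a * c) (q i I2)"
  | "V_gen a b c i I2 I1 = mscale (- a) (q i I3)"
  | "V_gen a b c i I2 I2 = mat (- i)"
  | "V_gen a b c i I2 I3 = mscale (- i * c) (q i I1)"
  | "V_gen a b c i I3 I0 = mscale (a * b) (q i I3)"
  | "V_gen a b c i I3 I1 = mscale (- i * a) (q i I2)"
  | "V_gen a b c i I3 I2 = mscale (- b) (q i I1)"
  | "V_gen a b c i I3 I3 = mat (- i)"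

definition monomial_act :: "(idx \<Rightarrow> 'k::field^2^2) \<Rightarrow> monomial \<Rightarrow> 'k^2 \<Rightarrow> 'k^2"
  where "monomial_act \<rho> w v = foldr (\<lambda>l. (*v) (\<rho> l)) (letters w) v"

text \<open>The action of \<open>S\<close> on \<^const>\<open>k2\<close> in which the \<open>l\<close>-th generator acts as \<open>\<rho> l\<close>.\<close>

definition V_act :: "(idx \<Rightarrow> 'k::field^2^2) \<Rightarrow> 'k free_alg set \<Rightarrow> 'k^2 \<Rightarrow> 'k^2"
  where "V_act \<rho> s v =
    (\<Sum>w\<in>Poly_Mapping.keys (rep s). Poly_Mapping.lookup (rep s) w *s monomial_act \<rho> w v)"


section \<open>The graded \<open>S\<close>-module \<open>F = V \<otimes> k[t]\<close>\<close>

definition kt :: "('k::field, 'k poly) module"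
  where "kt =
    \<lparr>carrier = UNIV, monoid.mult = (*), one = 1, ring.zero = 0, add = (+), module.smult = Polynomial.smult\<rparr>"

type_synonym 'k Fvec = "(('k^2) \<times> 'k poly \<Rightarrow>\<^sub>0 'k) set"

definition F :: "('k::field, 'k Fvec) module"
  where "F = tensor_space k2 kt"

definition F_degree :: "nat \<Rightarrow> 'k::field Fvec set"
  where "F_degree n = range (\<lambda>v. pure_tensor k2 kt v (Polynomial.monom 1 n))"

text \<open>\<open>s (v \<otimes> r) = \<Sum>\<^sub>n s\<^sub>n v \<otimes> t\<^sup>n r\<close>, where \<open>s\<^sub>n\<close> is the component of \<open>s\<close> of degree \<open>n\<close>.\<close>

definition F_act :: "(idx \<Rightarrow> 'k::field) \<Rightarrow> (idx \<Rightarrow> 'k^2^2) \<Rightarrow> 'k free_alg set \<Rightarrow> 'k Fvec \<Rightarrow> 'k Fvec"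
  where "F_act \<alpha> \<rho> s = tensor_lift F (\<lambda>v r.
    \<Oplus>\<^bsub>F\<^esub>n\<in>{n. S_component \<alpha> n s \<noteq> \<zero>\<^bsub>S \<alpha>\<^esub>}.
      pure_tensor k2 kt (V_act \<rho> (S_component \<alpha> n s) v) (Polynomial.monom 1 n * r))"


section \<open>The graded \<open>S'\<close>-module \<open>F \<otimes> k\<^sup>2\<close>\<close>

type_synonym 'k FKvec = "('k Fvec \<times> ('k^2) \<Rightarrow>\<^sub>0 'k) set"

definition FK :: "('k::field, 'k FKvec) module"
  where "FK = tensor_space F k2"

text \<open>The image of \<open>F\<^sub>n \<otimes> k\<^sup>2\<close> in \<open>F \<otimes> k\<^sup>2\<close>.\<close>

definition FK_degree :: "nat \<Rightarrow> 'k::field FKvec set"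
  where "FK_degree n = {tensor_class F k2 p | p. Poly_Mapping.keys p \<subseteq> F_degree n \<times> UNIV}"

text \<open>\<open>(s \<otimes> m) (f \<otimes> u) = s f \<otimes> m u\<close>\<close>

definition FK_act :: "(idx \<Rightarrow> 'k::field) \<Rightarrow> (idx \<Rightarrow> 'k^2^2) \<Rightarrow>
    ('k free_alg set \<times> ('k^2^2) \<Rightarrow>\<^sub>0 'k) set \<Rightarrow> 'k FKvec \<Rightarrow> 'k FKvec"
  where "FK_act \<alpha> \<rho> X Y =
    tensor_lift FK
      (\<lambda>s m. tensor_lift FK (\<lambda>f u. pure_tensor F k2 (F_act \<alpha> \<rho> s f) (m *v u)) Y) X"


section \<open>Equivariant structures\<close>

text \<open>
  Let \<open>A\<close> be an algebra on which the group \<open>G\<close> acts by \<open>\<gamma>\<close>, and let \<open>M\<close> be a graded \<open>A\<close>-module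
  with action \<open>act\<close> and homogeneous components \<open>deg n\<close>. A
  \<^const>\<open>group_action\<close> is by extensional functions, so that equal structures are equal as functions.
\<close>

definition equivariant_structures ::
    "'g monoid \<Rightarrow> ('k, 'a) module \<Rightarrow> ('g \<Rightarrow> 'a \<Rightarrow> 'a) \<Rightarrow>
     ('k, 'm) module \<Rightarrow> ('a \<Rightarrow> 'm \<Rightarrow> 'm) \<Rightarrow> (nat \<Rightarrow> 'm set) \<Rightarrow> ('g \<Rightarrow> 'm \<Rightarrow> 'm) set"
  where "equivariant_structures G A \<gamma> M act deg = {\<phi> \<in> extensional (carrier G).
      group_action G (carrier M) \<phi> \<and>
      (\<forall>g\<in>carrier G.
         (\<forall>m\<in>carrier M. \<forall>m'\<in>carrier M. \<phi> g (m \<oplus>\<^bsub>M\<^esub> m') = \<phi> g m \<oplus>\<^bsub>M\<^esub> \<phi> g m') \<and>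
         (\<forall>c. \<forall>m\<in>carrier M. \<phi> g (c \<odot>\<^bsub>M\<^esub> m) = c \<odot>\<^bsub>M\<^esub> \<phi> g m) \<and>
         (\<forall>n. \<phi> g ` deg n \<subseteq> deg n) \<and>
         (\<forall>y\<in>carrier A. \<forall>m\<in>carrier M. \<phi> g (act y m) = act (\<gamma> g y) (\<phi> g m)))}"

definition graded_module_isos ::
    "('k, 'a) module \<Rightarrow> ('k, 'm) module \<Rightarrow> ('a \<Rightarrow> 'm \<Rightarrow> 'm) \<Rightarrow> (nat \<Rightarrow> 'm set) \<Rightarrow> ('m \<Rightarrow> 'm) set"
  where "graded_module_isos A M act deg = {f. bij_betw f (carrier M) (carrier M) \<and>
      (\<forall>m\<in>carrier M. \<forall>m'\<in>carrier M. f (m \<oplus>\<^bsub>M\<^esub> m') = f m \<oplus>\<^bsub>M\<^esub> f m') \<and>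
      (\<forall>y\<in>carrier A. \<forall>m\<in>carrier M. f (act y m) = act y (f m)) \<and>
      (\<forall>n. f ` deg n = deg n)}"

definition equivariant_iso ::
    "'g monoid \<Rightarrow> ('k, 'a) module \<Rightarrow> ('g \<Rightarrow> 'a \<Rightarrow> 'a) \<Rightarrow>
     ('k, 'm) module \<Rightarrow> ('a \<Rightarrow> 'm \<Rightarrow> 'm) \<Rightarrow> (nat \<Rightarrow> 'm set) \<Rightarrow>
     (('g \<Rightarrow> 'm \<Rightarrow> 'm) \<times> ('g \<Rightarrow> 'm \<Rightarrow> 'm)) set"
  where "equivariant_iso G A \<gamma> M act deg = {(\<phi>, \<psi>).
      \<phi> \<in> equivariant_structures G A \<gamma> M act deg \<and> \<psi> \<in> equivariant_structures G A \<gamma> M act deg \<and>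
      (\<exists>f\<in>graded_module_isos A M act deg. \<forall>g\<in>carrier G. \<forall>m\<in>carrier M. f (\<phi> g m) = \<psi> g (f m))}"

end

theory Submission
  imports Defs
begin

text \<open>
  Write an element of \<open>k\<^sup>2 \<otimes> k\<^sup>2\<close> as a matrix, \<open>v \<otimes> u\<close> being \<open>v u\<^sup>T\<close>. Then \<open>F \<otimes> k\<^sup>2\<close> is the space of
  polynomials in \<open>t\<close> with coefficients in \<open>M\<^sub>2(k)\<close>, and for a word \<open>w\<close> of length \<open>l\<close> in the generators,
  which acts on \<open>V\<close> by the matrix \<open>\<rho>\<^sub>w\<close>, the element \<open>w \<otimes> m\<close> of \<open>S'\<close> sends \<open>A t\<^sup>n\<close> to
  \<open>\<rho>\<^sub>w A m\<^sup>T t\<^sup>n\<^sup>+\<^sup>l\<close> (\<open>FK_act_word\<close>).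

  In each of the four modules the generator \<open>x\<^sub>l\<close> acts as a nonzero multiple of \<open>q\<^bsub>j\<cdot>l\<^esub>\<close>, where \<open>j\<cdot>l\<close> is
  the product in \<open>\<Gamma>\<close> of the elements with these indices (\<open>V_gen_eq_q\<close>). So one argument
  serves all \<open>j\<close>. Up to sign the \<open>q\<^sub>g\<close> multiply like \<open>\<Gamma>\<close>, and \<open>q\<^sub>g\<close> and \<open>q\<^sub>h\<close> commute up to the sign
  \<open>\<langle>g, h\<rangle>\<close> by which \<open>g\<close> acts on \<open>x\<^sub>h\<close>. This sign is a nondegenerate symmetric bicharacter of \<open>\<Gamma>\<close>.

  Let a map of degree 0 be compatible with \<open>S'\<close> up to the action of \<open>g\<close> on \<open>S'\<close>. In degree \<open>n\<close> it is
  some map \<open>T\<^sub>n\<close> of matrices. Compatibility with \<open>1 \<otimes> M\<^sub>2(k)\<close> says that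
  \<open>T\<^sub>n A = P\<^sub>n A q\<^sub>g\<^sup>T\<close> for a matrix \<open>P\<^sub>n\<close>; compatibility with the
  generator \<open>x\<^sub>j\<close>, which acts by a scalar, says that \<open>P\<^sub>n\<^sub>+\<^sub>1 = \<langle>g, j\<rangle> P\<^sub>n\<close>; and compatibility with
  the other generators says that \<open>q\<^sub>g\<^sup>-\<^sup>1 P\<^sub>0\<close> commutes with all \<open>q\<^sub>h\<close>, hence is a scalar. So
  \<open>T\<^sub>n A = \<kappa> \<langle>g, j\<rangle>\<^sup>n q\<^sub>g A q\<^sub>g\<^sup>T\<close> (\<open>twisted_schur\<close>).

  In an equivariant structure the scalars \<open>\<kappa>\<close> form a character of \<open>\<Gamma>\<close>, since the maps
  \<open>A \<mapsto> q\<^sub>g A q\<^sub>g\<^sup>T\<close> compose like the elements of \<open>\<Gamma>\<close>: the signs of the \<open>q\<^sub>g\<close> occur twice. Conversely every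
  character gives a structure, and there are four characters, namely \<open>g \<mapsto> \<langle>h, g\<rangle>\<close> for \<open>h \<in> \<Gamma>\<close>
  (\<open>structures_eq\<close>). An isomorphism between two structures is an untwisted map, hence a scalar,
  and so the two structures are equal (\<open>structure_iso_imp_eq\<close>).

  All of these spaces are quotients and the maps between them are given by representatives.
  For the tensor products, independence of the representatives is the universal property
  (\<open>tensor_lift_pure\<close>, \<open>klinear_tensor_lift\<close>). For \<open>S\<close> it holds because the ideal of relations is
  homogeneous, is preserved by \<open>\<Gamma>\<close>, and acts as zero on \<open>V\<close>; all three follow from \<open>S_ideal_induct\<close>.
  Afterwards an identity between linear maps has to be checked only on the elements \<open>w \<otimes> m\<close> of \<open>S'\<close>
  and \<open>A t\<^sup>n\<close> of \<open>F \<otimes> k\<^sup>2\<close> (\<open>klinear_S'_eqI\<close>, \<open>klinear_FK_eqI_homog\<close>).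
\<close>

section \<open>Vector spaces and linear maps\<close>

text \<open>
  Inverses are multiples by \<open>- 1\<close>: the law \<open>0 \<odot> x = \<zero>\<close> makes an additive monoid a group.
\<close>

locale kspace = abelian_monoid V for V :: "('k::field, 'v) module" (structure) +
  assumes smult_closed [simp, intro]: "x \<in> carrier V \<Longrightarrow> c \<odot> x \<in> carrier V"
    and smult_add: "x \<in> carrier V \<Longrightarrow> y \<in> carrier V \<Longrightarrow> c \<odot> (x \<oplus> y) = c \<odot> x \<oplus> c \<odot> y"
    and add_smult: "x \<in> carrier V \<Longrightarrow> (c + d) \<odot> x = c \<odot> x \<oplus> d \<odot> x"
    and smult_smult: "x \<in> carrier V \<Longrightarrow> c \<odot> (d \<odot> x) = (c * d) \<odot> x"
    and one_smult [simp]: "x \<in> carrier V \<Longrightarrow> 1 \<odot> x = x"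
    and zero_smult [simp]: "x \<in> carrier V \<Longrightarrow> 0 \<odot> x = \<zero>"
begin

lemma smult_zero [simp]: "c \<odot> \<zero> = \<zero>"
  using smult_smult[of \<zero> c 0] by simp

lemma finsum_smult:
  assumes "f \<in> A \<rightarrow> carrier V"
  shows "(\<Oplus>x\<in>A. c \<odot> f x) = c \<odot> (\<Oplus>x\<in>A. f x)"
proof (cases "finite A")
  case True
  then show ?thesis
    using assms by (induction A rule: finite_induct) (simp_all add: Pi_iff smult_add)
qed simp

end

definition klinear :: "('k::field, 'v) module \<Rightarrow> ('k, 'u) module \<Rightarrow> ('v \<Rightarrow> 'u) \<Rightarrow> bool"
  where "klinear V U f \<longleftrightarrow> (\<forall>x\<in>carrier V. f x \<in> carrier U)
    \<and> (\<forall>x\<in>carrier V. \<forall>y\<in>carrier V. f (x \<oplus>\<^bsub>V\<^esub> y) = f x \<oplus>\<^bsub>U\<^esub> f y)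
    \<and> (\<forall>c. \<forall>x\<in>carrier V. f (c \<odot>\<^bsub>V\<^esub> x) = c \<odot>\<^bsub>U\<^esub> f x)"

definition kbilinear ::
    "('k::field, 'v) module \<Rightarrow> ('k, 'w) module \<Rightarrow> ('k, 'u) module \<Rightarrow> ('v \<Rightarrow> 'w \<Rightarrow> 'u) \<Rightarrow> bool"
  where "kbilinear V W U f \<longleftrightarrow>
    (\<forall>v\<in>carrier V. klinear W U (f v)) \<and> (\<forall>w\<in>carrier W. klinear V U (\<lambda>v. f v w))"

lemma klinearI:
  assumes "\<And>x. x \<in> carrier V \<Longrightarrow> f x \<in> carrier U"
    and "\<And>x y. x \<in> carrier V \<Longrightarrow> y \<in> carrier V \<Longrightarrow> f (x \<oplus>\<^bsub>V\<^esub> y) = f x \<oplus>\<^bsub>U\<^esub> f y"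
    and "\<And>c x. x \<in> carrier V \<Longrightarrow> f (c \<odot>\<^bsub>V\<^esub> x) = c \<odot>\<^bsub>U\<^esub> f x"
  shows "klinear V U f"
  using assms by (simp add: klinear_def)

lemma klinearD:
  assumes "klinear V U f"
  shows "\<And>x. x \<in> carrier V \<Longrightarrow> f x \<in> carrier U"
    and "\<And>x y. x \<in> carrier V \<Longrightarrow> y \<in> carrier V \<Longrightarrow> f (x \<oplus>\<^bsub>V\<^esub> y) = f x \<oplus>\<^bsub>U\<^esub> f y"
    and "\<And>c x. x \<in> carrier V \<Longrightarrow> f (c \<odot>\<^bsub>V\<^esub> x) = c \<odot>\<^bsub>U\<^esub> f x"
  using assms by (simp_all add: klinear_def)

lemma klinear_cong:
  assumes "klinear V U f" and "kspace V" and "\<And>x. x \<in> carrier V \<Longrightarrow> g x = f x"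
  shows "klinear V U g"
proof -
  interpret kspace V by fact
  show ?thesis
    using assms(1,3) by (simp add: klinear_def)
qed

lemma klinear_compose: "klinear V U f \<Longrightarrow> klinear U X g \<Longrightarrow> klinear V X (\<lambda>x. g (f x))"
  by (simp add: klinear_def)

lemma klinear_zero:
  assumes "klinear V U f" and "kspace V" and "kspace U"
  shows "f \<zero>\<^bsub>V\<^esub> = \<zero>\<^bsub>U\<^esub>"
proof -
  interpret V: kspace V by fact
  interpret U: kspace U by fact
  have "f \<zero>\<^bsub>V\<^esub> = f (0 \<odot>\<^bsub>V\<^esub> \<zero>\<^bsub>V\<^esub>)"
    by simp
  also have "\<dots> = 0 \<odot>\<^bsub>U\<^esub> f \<zero>\<^bsub>V\<^esub>"
    using klinearD(3)[OF assms(1)] V.zero_closed by blast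
  also have "\<dots> = \<zero>\<^bsub>U\<^esub>"
    using klinearD(1)[OF assms(1)] by simp
  finally show ?thesis .
qed

lemma kbilinearI:
  assumes "\<And>v w. v \<in> carrier V \<Longrightarrow> w \<in> carrier W \<Longrightarrow> f v w \<in> carrier U"
    and "\<And>v v' w. v \<in> carrier V \<Longrightarrow> v' \<in> carrier V \<Longrightarrow> w \<in> carrier W \<Longrightarrow>
      f (v \<oplus>\<^bsub>V\<^esub> v') w = f v w \<oplus>\<^bsub>U\<^esub> f v' w"
    and "\<And>v w w'. v \<in> carrier V \<Longrightarrow> w \<in> carrier W \<Longrightarrow> w' \<in> carrier W \<Longrightarrow>
      f v (w \<oplus>\<^bsub>W\<^esub> w') = f v w \<oplus>\<^bsub>U\<^esub> f v w'"
    and "\<And>c v w. v \<in> carrier V \<Longrightarrow> w \<in> carrier W \<Longrightarrow> f (c \<odot>\<^bsub>V\<^esub> v) w = c \<odot>\<^bsub>U\<^esub> f v w"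
    and "\<And>c v w. v \<in> carrier V \<Longrightarrow> w \<in> carrier W \<Longrightarrow> f v (c \<odot>\<^bsub>W\<^esub> w) = c \<odot>\<^bsub>U\<^esub> f v w"
  shows "kbilinear V W U f"
  using assms by (simp add: kbilinear_def klinear_def)

lemma kbilinearD:
  assumes "kbilinear V W U f"
  shows "\<And>v w. v \<in> carrier V \<Longrightarrow> w \<in> carrier W \<Longrightarrow> f v w \<in> carrier U"
    and "\<And>v v' w. v \<in> carrier V \<Longrightarrow> v' \<in> carrier V \<Longrightarrow> w \<in> carrier W \<Longrightarrow>
      f (v \<oplus>\<^bsub>V\<^esub> v') w = f v w \<oplus>\<^bsub>U\<^esub> f v' w"
    and "\<And>v w w'. v \<in> carrier V \<Longrightarrow> w \<in> carrier W \<Longrightarrow> w' \<in> carrier W \<Longrightarrow>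
      f v (w \<oplus>\<^bsub>W\<^esub> w') = f v w \<oplus>\<^bsub>U\<^esub> f v w'"
    and "\<And>c v w. v \<in> carrier V \<Longrightarrow> w \<in> carrier W \<Longrightarrow> f (c \<odot>\<^bsub>V\<^esub> v) w = c \<odot>\<^bsub>U\<^esub> f v w"
    and "\<And>c v w. v \<in> carrier V \<Longrightarrow> w \<in> carrier W \<Longrightarrow> f v (c \<odot>\<^bsub>W\<^esub> w) = c \<odot>\<^bsub>U\<^esub> f v w"
  using assms by (simp_all add: kbilinear_def klinear_def)

lemma kbilinear_compose:
  assumes f: "kbilinear V' W' U f" and g: "klinear V V' g" and h: "klinear W W' h"
  shows "kbilinear V W U (\<lambda>v w. f (g v) (h w))"
  by (rule kbilinearI) (simp_all add: kbilinearD[OF f] klinearD[OF g] klinearD[OF h])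

lemma kspace_cong:
  assumes "kspace V" and "carrier V' = carrier V" and "\<zero>\<^bsub>V'\<^esub> = \<zero>\<^bsub>V\<^esub>"
    and "add V' = add V" and "module.smult V' = module.smult V"
  shows "kspace V'"
proof -
  interpret V: kspace V by fact
  show ?thesis
    by (intro kspace.intro abelian_monoidI kspace_axioms.intro)
      (auto simp: assms(2-) V.smult_add V.add_smult V.smult_smult V.a_ac)
qed

lemma kbilinear_left: "kbilinear V W U f \<Longrightarrow> w \<in> carrier W \<Longrightarrow> klinear V U (\<lambda>v. f v w)"
  and kbilinear_right: "kbilinear V W U f \<Longrightarrow> v \<in> carrier V \<Longrightarrow> klinear W U (f v)"
  by (simp_all add: kbilinear_def)

lemma klinear_add_fun:
  assumes f: "klinear V U f" and g: "klinear V U g" and "kspace U"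
  shows "klinear V U (\<lambda>x. f x \<oplus>\<^bsub>U\<^esub> g x)"
proof -
  interpret U: kspace U by fact
  show ?thesis
    by (rule klinearI) (simp_all add: klinearD[OF f] klinearD[OF g] U.smult_add U.a_ac)
qed

lemma klinear_smult_fun:
  assumes f: "klinear V U f" and "kspace U"
  shows "klinear V U (\<lambda>x. c \<odot>\<^bsub>U\<^esub> f x)"
proof -
  interpret U: kspace U by fact
  show ?thesis
    by (rule klinearI) (simp_all add: klinearD[OF f] U.smult_add U.smult_smult mult.commute)
qed

lemma klinear_finsum_fun:
  assumes "\<And>n. n \<in> A \<Longrightarrow> klinear V U (f n)" and "kspace U" and "finite A"
  shows "klinear V U (\<lambda>x. \<Oplus>\<^bsub>U\<^esub>n\<in>A. f n x)"
proof -
  interpret U: kspace U by fact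
  have f: "klinear V U (f n)" if "n \<in> A" for n
    using assms(1) that .
  show ?thesis
  proof (rule klinearI)
    fix x assume x: "x \<in> carrier V"
    show "(\<Oplus>\<^bsub>U\<^esub>n\<in>A. f n x) \<in> carrier U"
      by (rule U.finsum_closed) (use x klinearD(1)[OF f] in auto)
    show "(\<Oplus>\<^bsub>U\<^esub>n\<in>A. f n (c \<odot>\<^bsub>V\<^esub> x)) = c \<odot>\<^bsub>U\<^esub> (\<Oplus>\<^bsub>U\<^esub>n\<in>A. f n x)" for c
      using x by (subst U.finsum_smult[symmetric])
        (auto simp: klinearD[OF f] Pi_iff intro!: U.finsum_cong')
    fix y assume y: "y \<in> carrier V"
    show "(\<Oplus>\<^bsub>U\<^esub>n\<in>A. f n (x \<oplus>\<^bsub>V\<^esub> y)) = (\<Oplus>\<^bsub>U\<^esub>n\<in>A. f n x) \<oplus>\<^bsub>U\<^esub> (\<Oplus>\<^bsub>U\<^esub>n\<in>A. f n y)"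
    proof -
      have "(\<Oplus>\<^bsub>U\<^esub>n\<in>A. f n (x \<oplus>\<^bsub>V\<^esub> y)) = (\<Oplus>\<^bsub>U\<^esub>n\<in>A. f n x \<oplus>\<^bsub>U\<^esub> f n y)"
        by (rule U.finsum_cong'[OF refl]) (use x y in \<open>simp_all add: klinearD[OF f] Pi_iff\<close>)
      also have "\<dots> = (\<Oplus>\<^bsub>U\<^esub>n\<in>A. f n x) \<oplus>\<^bsub>U\<^esub> (\<Oplus>\<^bsub>U\<^esub>n\<in>A. f n y)"
        by (rule U.finsum_addf) (use x y klinearD(1)[OF f] in auto)
      finally show ?thesis .
    qed
  qed
qed

section \<open>Finitely supported functions\<close>

lemma lookup_fscale [simp]: "Poly_Mapping.lookup (fscale c p) k = c * Poly_Mapping.lookup p k"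
  by (simp add: fscale_def Poly_Mapping.map.rep_eq when_def)

lemma fscale_single [simp]: "fscale c (Poly_Mapping.single k d) = Poly_Mapping.single k (c * d)"
  by (rule poly_mapping_eqI) (simp add: lookup_single when_def)

lemma fscale_add [simp]: "fscale c (p + p') = fscale c p + fscale c p'"
  by (rule poly_mapping_eqI) (simp add: lookup_add algebra_simps)

lemma fscale_diff [simp]: "fscale c (p - p') = fscale c p - fscale c p'"
  by (rule poly_mapping_eqI) (simp add: lookup_minus algebra_simps)

lemma fscale_zero [simp]: "fscale c 0 = 0"
  by (rule poly_mapping_eqI) simp

lemma module_fscale: "Modules.module fscale"
  by unfold_locales (auto intro!: poly_mapping_eqI simp: lookup_add algebra_simps)

lemma keys_fscale: "Poly_Mapping.keys (fscale c p) \<subseteq> Poly_Mapping.keys p"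
  by (auto simp: in_keys_iff)

lemma finsupp_expansion:
  fixes p :: "'x \<Rightarrow>\<^sub>0 'b::comm_monoid_add"
  shows "p = (\<Sum>k\<in>Poly_Mapping.keys p. Poly_Mapping.single k (Poly_Mapping.lookup p k))"
  by (rule poly_mapping_eqI)
    (auto simp: lookup_sum lookup_single when_def in_keys_iff sum.delta)

lemma finsupp_induct [consumes 1, case_names zero single add]:
  fixes p :: "'x \<Rightarrow>\<^sub>0 'b::comm_monoid_add"
  assumes keys: "Poly_Mapping.keys p \<subseteq> K"
    and "P 0" and single: "\<And>k c. k \<in> K \<Longrightarrow> P (Poly_Mapping.single k c)"
    and add: "\<And>p q. Poly_Mapping.keys p \<subseteq> K \<Longrightarrow> Poly_Mapping.keys q \<subseteq> K \<Longrightarrow> P p \<Longrightarrow> P q \<Longrightarrow> P (p + q)"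
  shows "P p"
proof -
  have "P (\<Sum>k\<in>A. Poly_Mapping.single k (Poly_Mapping.lookup p k)) \<and>
      Poly_Mapping.keys (\<Sum>k\<in>A. Poly_Mapping.single k (Poly_Mapping.lookup p k)) \<subseteq> K"
    if "finite A" "A \<subseteq> K" for A
    using that
  proof (induction A rule: finite_induct)
    case empty
    then show ?case using assms(2) by simp
  next
    case (insert x A)
    have "Poly_Mapping.keys (Poly_Mapping.single x (Poly_Mapping.lookup p x)) \<subseteq> K"
      using insert by auto
    with insert show ?case
      by (auto intro!: add single dest!: subsetD[OF keys_add])
  qed
  from this[OF finite_keys keys] show ?thesis
    using finsupp_expansion[of p] by simp
qed

context kspace
begin

definition lin_ext :: "('x \<Rightarrow> 'v) \<Rightarrow> ('x \<Rightarrow>\<^sub>0 'k) \<Rightarrow> 'v"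
  where "lin_ext h p = (\<Oplus>z\<in>Poly_Mapping.keys p. Poly_Mapping.lookup p z \<odot> h z)"

lemma lin_ext_superset:
  assumes "finite A" and "Poly_Mapping.keys p \<subseteq> A" and "h \<in> A \<rightarrow> carrier V"
  shows "lin_ext h p = (\<Oplus>z\<in>A. Poly_Mapping.lookup p z \<odot> h z)"
  unfolding lin_ext_def
  by (rule add.finprod_mono_neutral_cong_left) (use assms in \<open>auto simp: in_keys_iff Pi_iff\<close>)

lemma lin_ext_closed:
  assumes "h \<in> K \<rightarrow> carrier V" and "Poly_Mapping.keys p \<subseteq> K"
  shows "lin_ext h p \<in> carrier V"
  unfolding lin_ext_def by (rule finsum_closed) (use assms in auto)

lemma lin_ext_add:
  assumes h: "h \<in> K \<rightarrow> carrier V" and "Poly_Mapping.keys p \<subseteq> K" and "Poly_Mapping.keys p' \<subseteq> K"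
  shows "lin_ext h (p + p') = lin_ext h p \<oplus> lin_ext h p'"
proof -
  define A where "A = Poly_Mapping.keys p \<union> Poly_Mapping.keys p'"
  have A: "finite A" "h \<in> A \<rightarrow> carrier V"
    using assms by (auto simp: A_def)
  have "lin_ext h (p + p') = (\<Oplus>z\<in>A. (Poly_Mapping.lookup p z + Poly_Mapping.lookup p' z) \<odot> h z)"
    using lin_ext_superset[OF A(1) _ A(2), of "p + p'"] keys_add[of p p'] by (simp add: A_def lookup_add)
  also have "\<dots> = (\<Oplus>z\<in>A. Poly_Mapping.lookup p z \<odot> h z \<oplus> Poly_Mapping.lookup p' z \<odot> h z)"
    by (rule finsum_cong') (use A(2) in \<open>auto simp: add_smult Pi_iff\<close>)
  also have "\<dots> = (\<Oplus>z\<in>A. Poly_Mapping.lookup p z \<odot> h z) \<oplus> (\<Oplus>z\<in>A. Poly_Mapping.lookup p' z \<odot> h z)"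
    by (rule finsum_addf) (use A(2) in auto)
  also have "\<dots> = lin_ext h p \<oplus> lin_ext h p'"
    using lin_ext_superset[OF A(1) _ A(2), of p] lin_ext_superset[OF A(1) _ A(2), of p']
    by (simp add: A_def)
  finally show ?thesis .
qed

lemma lin_ext_fscale:
  assumes h: "h \<in> K \<rightarrow> carrier V" and "Poly_Mapping.keys p \<subseteq> K"
  shows "lin_ext h (fscale c p) = c \<odot> lin_ext h p"
proof -
  have h': "h \<in> Poly_Mapping.keys p \<rightarrow> carrier V"
    using assms by auto
  have "lin_ext h (fscale c p) = (\<Oplus>z\<in>Poly_Mapping.keys p. c \<odot> (Poly_Mapping.lookup p z \<odot> h z))"
    unfolding lin_ext_superset[OF finite_keys keys_fscale h']
    by (rule finsum_cong') (use h' in \<open>auto simp: smult_smult Pi_iff\<close>)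
  also have "\<dots> = c \<odot> lin_ext h p"
    unfolding lin_ext_def by (rule finsum_smult) (use h' in auto)
  finally show ?thesis .
qed

lemma lin_ext_zero [simp]: "lin_ext h 0 = \<zero>"
  by (simp add: lin_ext_def)

lemma lin_ext_single:
  assumes "h z \<in> carrier V"
  shows "lin_ext h (Poly_Mapping.single z c) = c \<odot> h z"
proof -
  have "lin_ext h (Poly_Mapping.single z c) = (\<Oplus>y\<in>{z}. Poly_Mapping.lookup (Poly_Mapping.single z c) y \<odot> h y)"
    by (rule lin_ext_superset) (use assms in auto)
  then show ?thesis
    using assms by (simp add: finsum_insert)
qed

end

section \<open>Tensor products\<close>

lemma rep_in: "x \<in> X \<Longrightarrow> rep X \<in> X"
  unfolding rep_def by (rule someI)

context
  fixes V :: "('k::field, 'v) module" and W :: "('k, 'w) module"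
begin

interpretation fs: Modules.module "fscale :: 'k \<Rightarrow> ('v \<times> 'w \<Rightarrow>\<^sub>0 'k) \<Rightarrow> _"
  by (rule module_fscale)

lemma tensor_class_eq_iff:
  "tensor_class V W p = tensor_class V W p' \<longleftrightarrow> p - p' \<in> fs.span (bilinear_rels V W)"
proof
  assume "tensor_class V W p = tensor_class V W p'"
  moreover have "p \<in> tensor_class V W p"
    by (simp add: tensor_class_def fs.span_zero)
  ultimately show "p - p' \<in> fs.span (bilinear_rels V W)"
    by (simp add: tensor_class_def)
next
  assume *: "p - p' \<in> fs.span (bilinear_rels V W)"
  show "tensor_class V W p = tensor_class V W p'"
    unfolding tensor_class_def
    using fs.span_add[OF _ *] fs.span_diff[OF _ *] by (force simp: algebra_simps)
qed

lemma tensor_class_rep: "rep (tensor_class V W p) - p \<in> fs.span (bilinear_rels V W)"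
proof -
  have "p \<in> tensor_class V W p"
    by (simp add: tensor_class_def fs.span_zero)
  from rep_in[OF this] show ?thesis
    by (simp add: tensor_class_def)
qed

lemma tensor_space_add [simp]:
  "tensor_class V W p \<oplus>\<^bsub>tensor_space V W\<^esub> tensor_class V W p' = tensor_class V W (p + p')"
proof -
  have "(rep (tensor_class V W p) - p) + (rep (tensor_class V W p') - p') \<in> fs.span (bilinear_rels V W)"
    by (intro fs.span_add tensor_class_rep)
  then show ?thesis
    by (simp add: tensor_space_def tensor_class_eq_iff algebra_simps)
qed

lemma tensor_space_smult [simp]:
  "c \<odot>\<^bsub>tensor_space V W\<^esub> tensor_class V W p = tensor_class V W (fscale c p)"
proof -
  have "fscale c (rep (tensor_class V W p) - p) \<in> fs.span (bilinear_rels V W)"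
    by (intro fs.span_scale tensor_class_rep)
  then show ?thesis
    by (simp add: tensor_space_def tensor_class_eq_iff fs.scale_right_diff_distrib)
qed

lemma tensor_space_zero: "\<zero>\<^bsub>tensor_space V W\<^esub> = tensor_class V W 0"
  by (simp add: tensor_space_def)

lemma tensor_space_carrierI [intro]:
  "Poly_Mapping.keys p \<subseteq> carrier V \<times> carrier W \<Longrightarrow> tensor_class V W p \<in> carrier (tensor_space V W)"
  by (auto simp: tensor_space_def)

lemma tensor_space_carrierE:
  assumes "X \<in> carrier (tensor_space V W)"
  obtains p where "X = tensor_class V W p" and "Poly_Mapping.keys p \<subseteq> carrier V \<times> carrier W"
  using assms by (auto simp: tensor_space_def)

lemma kspace_tensor_space: "kspace (tensor_space V W)"
proof (intro kspace.intro abelian_monoidI kspace_axioms.intro)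
  let ?T = "tensor_space V W"
  show "\<zero>\<^bsub>?T\<^esub> \<in> carrier ?T"
    by (auto simp: tensor_space_zero)
  show "x \<oplus>\<^bsub>?T\<^esub> y \<in> carrier ?T" if xy: "x \<in> carrier ?T" "y \<in> carrier ?T" for x y
  proof -
    obtain p p' where p: "x = tensor_class V W p" "Poly_Mapping.keys p \<subseteq> carrier V \<times> carrier W"
      and p': "y = tensor_class V W p'" "Poly_Mapping.keys p' \<subseteq> carrier V \<times> carrier W"
      using xy by (metis tensor_space_carrierE)
    have "Poly_Mapping.keys (p + p') \<subseteq> carrier V \<times> carrier W"
      using keys_add[of p p'] p p' by blast
    then show ?thesis
      using p p' by auto
  qed
  show "c \<odot>\<^bsub>?T\<^esub> x \<in> carrier ?T" if "x \<in> carrier ?T" for c x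
  proof -
    obtain p where p: "x = tensor_class V W p" "Poly_Mapping.keys p \<subseteq> carrier V \<times> carrier W"
      using \<open>x \<in> carrier ?T\<close> by (rule tensor_space_carrierE)
    then show ?thesis
      using subset_trans[OF keys_fscale p(2)] by auto
  qed
qed (auto elim!: tensor_space_carrierE simp: tensor_space_zero algebra_simps fs.scale_right_distrib
      fs.scale_left_distrib)

lemma kbilinear_pure_tensor: "kbilinear V W (tensor_space V W) (pure_tensor V W)"
proof (rule kbilinearI)
  fix v w assume "v \<in> carrier V" "w \<in> carrier W"
  then show "pure_tensor V W v w \<in> carrier (tensor_space V W)"
    by (auto simp: pure_tensor_def)
  fix c
  show "pure_tensor V W (c \<odot>\<^bsub>V\<^esub> v) w = c \<odot>\<^bsub>tensor_space V W\<^esub> pure_tensor V W v w"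
    using \<open>v \<in> carrier V\<close> \<open>w \<in> carrier W\<close>
    by (auto simp: pure_tensor_def tensor_class_eq_iff bilinear_rels_def simp del: fscale_single intro!: fs.span_base)
  show "pure_tensor V W v (c \<odot>\<^bsub>W\<^esub> w) = c \<odot>\<^bsub>tensor_space V W\<^esub> pure_tensor V W v w"
    using \<open>v \<in> carrier V\<close> \<open>w \<in> carrier W\<close>
    by (auto simp: pure_tensor_def tensor_class_eq_iff bilinear_rels_def simp del: fscale_single intro!: fs.span_base)
next
  fix v v' w assume "v \<in> carrier V" "v' \<in> carrier V" "w \<in> carrier W"
  then show "pure_tensor V W (v \<oplus>\<^bsub>V\<^esub> v') w = pure_tensor V W v w \<oplus>\<^bsub>tensor_space V W\<^esub> pure_tensor V W v' w"
    by (auto simp: pure_tensor_def tensor_class_eq_iff bilinear_rels_def diff_diff_eq[symmetric] intro!: fs.span_base)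
next
  fix v w w' assume "v \<in> carrier V" "w \<in> carrier W" "w' \<in> carrier W"
  then show "pure_tensor V W v (w \<oplus>\<^bsub>W\<^esub> w') = pure_tensor V W v w \<oplus>\<^bsub>tensor_space V W\<^esub> pure_tensor V W v w'"
    by (auto simp: pure_tensor_def tensor_class_eq_iff bilinear_rels_def diff_diff_eq[symmetric] intro!: fs.span_base)
qed

lemma tensor_space_induct [consumes 1, case_names pure add smult]:
  assumes X: "X \<in> carrier (tensor_space V W)"
    and pure: "\<And>v w. v \<in> carrier V \<Longrightarrow> w \<in> carrier W \<Longrightarrow> P (pure_tensor V W v w)"
    and add: "\<And>X Y. X \<in> carrier (tensor_space V W) \<Longrightarrow> Y \<in> carrier (tensor_space V W) \<Longrightarrow>
      P X \<Longrightarrow> P Y \<Longrightarrow> P (X \<oplus>\<^bsub>tensor_space V W\<^esub> Y)"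
    and smult: "\<And>c X. X \<in> carrier (tensor_space V W) \<Longrightarrow> P X \<Longrightarrow> P (c \<odot>\<^bsub>tensor_space V W\<^esub> X)"
    and nonempty: "carrier V \<noteq> {}" "carrier W \<noteq> {}"
  shows "P X"
proof -
  obtain v0 w0 where vw0: "v0 \<in> carrier V" "w0 \<in> carrier W"
    using nonempty by blast
  obtain p where p: "X = tensor_class V W p" "Poly_Mapping.keys p \<subseteq> carrier V \<times> carrier W"
    using X by (rule tensor_space_carrierE)
  have single: "P (tensor_class V W (Poly_Mapping.single (v, w) c))"
    if "v \<in> carrier V" "w \<in> carrier W" for v w c
    using smult[OF _ pure[OF that], of c] kbilinearD(1)[OF kbilinear_pure_tensor that]
    by (simp add: pure_tensor_def)
  from p(2) have "P (tensor_class V W p)"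
  proof (induction p rule: finsupp_induct)
    case zero
    then show ?case using single[OF vw0, of 0] by simp
  next
    case (single z c)
    then show ?case using \<open>\<And>v w c. \<lbrakk>v \<in> carrier V; w \<in> carrier W\<rbrakk> \<Longrightarrow> P (tensor_class V W (Poly_Mapping.single (v, w) c))\<close>
      by (cases z) auto
  next
    case (add p q)
    then show ?case
      using assms(3)[of "tensor_class V W p" "tensor_class V W q"] by auto
  qed
  then show ?thesis
    by (simp add: p(1))
qed

context
  fixes U :: "('k, 'u) module" and f
  assumes V: "kspace V" and W: "kspace W" and U: "kspace U" and f: "kbilinear V W U f"
begin

interpretation V: kspace V by (rule V)
interpretation W: kspace W by (rule W)
interpretation U: kspace U by (rule U)

text \<open>
  The elements supported in \<open>carrier V \<times> carrier W\<close> on which the linear extension of \<open>f\<close> vanishes form a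
  subspace. Bilinearity of \<open>f\<close> puts the generators of the relations in it.
\<close>

lemma lin_ext_bilinear_rels:
  assumes "p \<in> fs.span (bilinear_rels V W)"
  shows "Poly_Mapping.keys p \<subseteq> carrier V \<times> carrier W \<and> U.lin_ext (\<lambda>z. f (fst z) (snd z)) p = \<zero>\<^bsub>U\<^esub>"
proof -
  let ?h = "\<lambda>z. f (fst z) (snd z)" and ?C = "carrier V \<times> carrier W"
  define K where "K x \<longleftrightarrow> Poly_Mapping.keys x \<subseteq> ?C" for x :: "'v \<times> 'w \<Rightarrow>\<^sub>0 'k"
  let ?Z = "{p. K p \<and> U.lin_ext ?h p = \<zero>\<^bsub>U\<^esub>}"
  note fD = kbilinearD[OF f]
  have h: "?h \<in> ?C \<rightarrow> carrier U"
    using fD(1) by auto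
  have K_zero [simp]: "K 0"
    by (simp add: K_def)
  have K_add [simp]: "K (x + y)" if "K x" "K y" for x y
    using keys_add[of x y] that by (auto simp: K_def)
  have K_fscale [simp]: "K (fscale c x)" if "K x" for c x
    using keys_fscale[of c x] that by (auto simp: K_def)
  have K_single [simp]: "K (Poly_Mapping.single z d)" if "z \<in> ?C" for z d
    using that by (simp add: K_def)
  have lin_ext_add: "U.lin_ext ?h (x + y) = U.lin_ext ?h x \<oplus>\<^bsub>U\<^esub> U.lin_ext ?h y" if "K x" "K y" for x y
    using U.lin_ext_add[OF h] that by (simp add: K_def)
  have lin_ext_fscale: "U.lin_ext ?h (fscale d x) = d \<odot>\<^bsub>U\<^esub> U.lin_ext ?h x" if "K x" for d x
    using U.lin_ext_fscale[OF h] that by (simp add: K_def)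
  have "fs.subspace ?Z"
    by (rule fs.subspaceI) (auto simp: lin_ext_add lin_ext_fscale)
  moreover have "bilinear_rels V W \<subseteq> ?Z"
  proof -
    have diff: "x - y = x + fscale (- 1) y" for x y :: "'v \<times> 'w \<Rightarrow>\<^sub>0 'k"
      by (rule poly_mapping_eqI) (simp add: lookup_add lookup_minus)
    have cancel: "X \<oplus>\<^bsub>U\<^esub> (- d) \<odot>\<^bsub>U\<^esub> Y = \<zero>\<^bsub>U\<^esub>" if "Y \<in> carrier U" "X = d \<odot>\<^bsub>U\<^esub> Y" for X Y d
      using U.add_smult[OF that(1), of d "- d"] that by simp
    have cancel2: "X \<oplus>\<^bsub>U\<^esub> Y \<oplus>\<^bsub>U\<^esub> (- 1) \<odot>\<^bsub>U\<^esub> X \<oplus>\<^bsub>U\<^esub> (- 1) \<odot>\<^bsub>U\<^esub> Y = \<zero>\<^bsub>U\<^esub>"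
      if "X \<in> carrier U" "Y \<in> carrier U" for X Y
      using cancel[of "X \<oplus>\<^bsub>U\<^esub> Y" "X \<oplus>\<^bsub>U\<^esub> Y" 1] that by (simp add: U.smult_add U.a_assoc)
    show ?thesis
      unfolding bilinear_rels_def diff fscale_single
      by (intro Un_least subsetI)
        (auto simp: lin_ext_add U.lin_ext_single fD cancel cancel2)
  qed
  ultimately have "p \<in> ?Z"
    using fs.span_minimal assms by blast
  then show ?thesis
    by (simp add: K_def)
qed

text \<open>
  The chosen representative differs from \<open>p\<close> by relations, on which the linear extension of \<open>f\<close> vanishes.
\<close>

lemma tensor_lift_class:
  assumes "Poly_Mapping.keys p \<subseteq> carrier V \<times> carrier W"
  shows "tensor_lift U f (tensor_class V W p) = U.lin_ext (\<lambda>z. f (fst z) (snd z)) p"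
proof -
  let ?h = "\<lambda>z. f (fst z) (snd z)" and ?r = "rep (tensor_class V W p)"
  have h: "?h \<in> carrier V \<times> carrier W \<rightarrow> carrier U"
    using kbilinearD(1)[OF f] by auto
  note d = lin_ext_bilinear_rels[OF tensor_class_rep[of p]]
  have "U.lin_ext ?h ?r = U.lin_ext ?h (?r - p + p)"
    by simp
  also have "\<dots> = U.lin_ext ?h (?r - p) \<oplus>\<^bsub>U\<^esub> U.lin_ext ?h p"
    using d assms by (intro U.lin_ext_add[OF h]) auto
  also have "\<dots> = U.lin_ext ?h p"
    using d U.lin_ext_closed[OF h assms] by simp
  finally show ?thesis
    by (simp add: tensor_lift_def U.lin_ext_def)
qed

lemma tensor_lift_pure:
  assumes "v \<in> carrier V" and "w \<in> carrier W"
  shows "tensor_lift U f (pure_tensor V W v w) = f v w"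
  using assms kbilinearD(1)[OF f assms]
  by (simp add: pure_tensor_def tensor_lift_class U.lin_ext_single)

lemma klinear_tensor_lift: "klinear (tensor_space V W) U (tensor_lift U f)"
proof (rule klinearI)
  let ?h = "\<lambda>z. f (fst z) (snd z)" and ?C = "carrier V \<times> carrier W"
  have h: "?h \<in> ?C \<rightarrow> carrier U"
    using kbilinearD(1)[OF f] by auto
  fix x assume "x \<in> carrier (tensor_space V W)"
  then obtain p where p: "x = tensor_class V W p" "Poly_Mapping.keys p \<subseteq> ?C"
    by (rule tensor_space_carrierE)
  show "tensor_lift U f x \<in> carrier U"
    using p U.lin_ext_closed[OF h] by (simp add: tensor_lift_class)
  show "tensor_lift U f (c \<odot>\<^bsub>tensor_space V W\<^esub> x) = c \<odot>\<^bsub>U\<^esub> tensor_lift U f x" for c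
    using p keys_fscale[of c p] U.lin_ext_fscale[OF h p(2)]
    by (simp add: tensor_lift_class subset_trans[OF keys_fscale])
  fix y assume "y \<in> carrier (tensor_space V W)"
  then obtain p' where p': "y = tensor_class V W p'" "Poly_Mapping.keys p' \<subseteq> ?C"
    by (rule tensor_space_carrierE)
  have "Poly_Mapping.keys (p + p') \<subseteq> ?C"
    using keys_add[of p p'] p p' by blast
  then show "tensor_lift U f (x \<oplus>\<^bsub>tensor_space V W\<^esub> y) = tensor_lift U f x \<oplus>\<^bsub>U\<^esub> tensor_lift U f y"
    using p p' U.lin_ext_add[OF h p(2) p'(2)] by (simp add: tensor_lift_class)
qed

end

text \<open>
  The uniqueness part of the universal property.
\<close>

lemma klinear_tensor_eqI:
  assumes f: "klinear (tensor_space V W) U f" and g: "klinear (tensor_space V W) U g"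
    and eq: "\<And>v w. v \<in> carrier V \<Longrightarrow> w \<in> carrier W \<Longrightarrow> f (pure_tensor V W v w) = g (pure_tensor V W v w)"
    and "kspace V" "kspace W" and X: "X \<in> carrier (tensor_space V W)"
  shows "f X = g X"
proof -
  interpret V: kspace V by fact
  interpret W: kspace W by fact
  show ?thesis
    using X
    by (induction X rule: tensor_space_induct) (auto simp: eq klinearD[OF f] klinearD[OF g])
qed

end

section \<open>The algebra S\<close>

lemma ring_free_algebra: "ring (free_algebra :: ('k::field, 'k free_alg) module)"
proof (intro ringI abelian_groupI monoidI)
  fix x :: "'k free_alg"
  assume "x \<in> carrier free_algebra"
  show "\<exists>y\<in>carrier free_algebra. y \<oplus>\<^bsub>free_algebra\<^esub> x = \<zero>\<^bsub>free_algebra\<^esub>"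
    by (rule bexI[of _ "- x"]) (simp_all add: free_algebra_def)
qed (simp_all add: free_algebra_def algebra_simps)

context
  fixes \<alpha> :: "idx \<Rightarrow> 'k::field"
begin

interpretation R: ring "free_algebra :: ('k, 'k free_alg) module"
  by (rule ring_free_algebra)

lemma ideal_S_ideal: "ideal (S_ideal \<alpha>) free_algebra"
  unfolding S_ideal_def by (rule R.genideal_ideal) (simp add: free_algebra_def)

interpretation I: ideal "S_ideal \<alpha>" free_algebra
  by (rule ideal_S_ideal)

lemma S_ideal_mult_left: "x \<in> S_ideal \<alpha> \<Longrightarrow> y * x \<in> S_ideal \<alpha>"
  using I.I_l_closed[of x y] by (simp add: free_algebra_def)

lemma S_ideal_mult_right: "x \<in> S_ideal \<alpha> \<Longrightarrow> x * y \<in> S_ideal \<alpha>"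
  using I.I_r_closed[of x y] by (simp add: free_algebra_def)

lemma S_ideal_add: "x \<in> S_ideal \<alpha> \<Longrightarrow> y \<in> S_ideal \<alpha> \<Longrightarrow> x + y \<in> S_ideal \<alpha>"
  using I.a_closed[of x y] by (simp add: free_algebra_def)

lemma S_ideal_zero: "0 \<in> S_ideal \<alpha>"
  using I.zero_closed by (simp add: free_algebra_def)

lemma S_ideal_uminus: "x \<in> S_ideal \<alpha> \<Longrightarrow> - x \<in> S_ideal \<alpha>"
  using S_ideal_mult_left[of x "- 1"] by simp

lemma S_ideal_diff: "x \<in> S_ideal \<alpha> \<Longrightarrow> y \<in> S_ideal \<alpha> \<Longrightarrow> x - y \<in> S_ideal \<alpha>"
  using S_ideal_add[of x "- y"] S_ideal_uminus[of y] by simp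

lemma S_ideal_fscale: "x \<in> S_ideal \<alpha> \<Longrightarrow> fscale d x \<in> S_ideal \<alpha>"
  using S_ideal_mult_left[of x "Poly_Mapping.single 0 d"]
  by (simp add: fscale_def mult_map_scale_conv_mult)

lemma S_ideal_relations: "r \<in> S_relations \<alpha> \<Longrightarrow> r \<in> S_ideal \<alpha>"
  unfolding S_ideal_def
  using R.genideal_self[of "S_relations \<alpha>"] by (auto simp: free_algebra_def)

text \<open>
  The elements with property \<open>P\<close> form an ideal that contains the relations. It is enough that \<open>P\<close>
  survives multiplication by a single term, since every element of the free algebra is a sum of terms.
\<close>

lemma S_ideal_induct [consumes 1, case_names relation zero add left right]:
  assumes p: "p \<in> S_ideal \<alpha>"
    and relation: "\<And>r. r \<in> S_relations \<alpha> \<Longrightarrow> P r"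
    and zero: "P 0"
    and add: "\<And>x y. P x \<Longrightarrow> P y \<Longrightarrow> P (x + y)"
    and left: "\<And>w d x. P x \<Longrightarrow> P (Poly_Mapping.single w d * x)"
    and right: "\<And>w d x. P x \<Longrightarrow> P (x * Poly_Mapping.single w d)"
  shows "P p"
proof -
  have l: "P (y * x)" if "P x" for x y
    by (rule finsupp_induct[of y UNIV]) (auto simp: zero distrib_right intro: add left that)
  have r: "P (x * y)" if "P x" for x y
    by (rule finsupp_induct[of y UNIV]) (auto simp: zero distrib_left intro: add right that)
  have neg: "P (- x)" if "P x" for x
    using l[OF that, of "- 1"] by simp
  have inv: "inv\<^bsub>add_monoid free_algebra\<^esub> x = - x" for x :: "'k free_alg"
    using R.minus_equality[of "- x" x] by (simp add: free_algebra_def a_inv_def)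
  have "subgroup (Collect P) (add_monoid free_algebra)"
    by (rule subgroup.intro) (auto simp: inv, auto simp: free_algebra_def intro: add zero neg)
  then have "ideal (Collect P) free_algebra"
    by (rule idealI[OF ring_free_algebra]) (auto simp: free_algebra_def intro: l r)
  then have "S_ideal \<alpha> \<subseteq> Collect P"
    unfolding S_ideal_def by (rule R.genideal_minimal) (auto intro: relation)
  then show ?thesis
    using p by blast
qed

lemma mem_S_class: "p' \<in> S_class \<alpha> p \<longleftrightarrow> p' - p \<in> S_ideal \<alpha>"
proof -
  have "p' \<in> S_class \<alpha> p \<longleftrightarrow> (\<exists>h\<in>S_ideal \<alpha>. p' = h + p)"
    by (simp add: S_class_def a_r_coset_def' free_algebra_def)
  also have "\<dots> \<longleftrightarrow> p' - p \<in> S_ideal \<alpha>"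
    by (metis add_diff_cancel_right' diff_add_cancel)
  finally show ?thesis .
qed

lemma S_class_eq_iff: "S_class \<alpha> p = S_class \<alpha> p' \<longleftrightarrow> p - p' \<in> S_ideal \<alpha>"
proof
  assume "S_class \<alpha> p = S_class \<alpha> p'"
  then show "p - p' \<in> S_ideal \<alpha>"
    using mem_S_class[of p p] mem_S_class[of p p'] S_ideal_zero by simp
next
  assume *: "p - p' \<in> S_ideal \<alpha>"
  have "x - p \<in> S_ideal \<alpha> \<longleftrightarrow> x - p' \<in> S_ideal \<alpha>" for x
    using S_ideal_add[OF _ *, of "x - p"] S_ideal_diff[OF _ *, of "x - p'"] by auto
  then show "S_class \<alpha> p = S_class \<alpha> p'"
    by (auto simp: mem_S_class)
qed

lemma rep_S_class: "rep (S_class \<alpha> p) - p \<in> S_ideal \<alpha>"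
proof -
  have "p \<in> S_class \<alpha> p"
    by (simp add: mem_S_class S_ideal_zero)
  from rep_in[OF this] show ?thesis
    by (simp add: mem_S_class)
qed

lemma S_carrier: "carrier (S \<alpha>) = range (S_class \<alpha>)"
proof -
  have "carrier (S \<alpha>) = a_rcosets\<^bsub>free_algebra\<^esub> (S_ideal \<alpha>)"
    by (simp add: S_def ring.defs module.defs FactRing_def)
  then show ?thesis
    by (auto simp: A_RCOSETS_def' S_class_def free_algebra_def)
qed

lemma S_class_carrier [simp, intro]: "S_class \<alpha> p \<in> carrier (S \<alpha>)"
  by (simp add: S_carrier)

lemma S_zero: "\<zero>\<^bsub>S \<alpha>\<^esub> = S_class \<alpha> 0"
proof -
  have "\<zero>\<^bsub>S \<alpha>\<^esub> = S_ideal \<alpha>"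
    by (simp add: S_def ring.defs module.defs FactRing_def)
  also have "S_ideal \<alpha> = S_class \<alpha> 0"
    by (simp add: set_eq_iff mem_S_class)
  finally show ?thesis .
qed

lemma S_add [simp]: "S_class \<alpha> p \<oplus>\<^bsub>S \<alpha>\<^esub> S_class \<alpha> p' = S_class \<alpha> (p + p')"
proof -
  have "S_class \<alpha> p \<oplus>\<^bsub>S \<alpha>\<^esub> S_class \<alpha> p' = S_class \<alpha> p <+>\<^bsub>free_algebra\<^esub> S_class \<alpha> p'"
    by (simp add: S_def ring.defs module.defs FactRing_def)
  also have "\<dots> = S_ideal \<alpha> +>\<^bsub>free_algebra\<^esub> (p \<oplus>\<^bsub>free_algebra\<^esub> p')"
    unfolding S_class_def by (rule I.a_rcos_sum) (simp_all add: free_algebra_def)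
  also have "p \<oplus>\<^bsub>free_algebra\<^esub> p' = p + p'"
    by (simp add: free_algebra_def)
  finally show ?thesis
    by (simp add: S_class_def)
qed

lemma S_smult [simp]: "d \<odot>\<^bsub>S \<alpha>\<^esub> S_class \<alpha> p = S_class \<alpha> (fscale d p)"
proof -
  have "fscale d (rep (S_class \<alpha> p)) - fscale d p \<in> S_ideal \<alpha>"
    using S_ideal_fscale[OF rep_S_class[of p], of d] by simp
  then show ?thesis
    by (simp add: S_def ring.defs module.defs S_class_eq_iff)
qed

lemma kspace_S: "kspace (S \<alpha>)"
proof -
  interpret fs: Modules.module "fscale :: 'k \<Rightarrow> 'k free_alg \<Rightarrow> _"
    by (rule module_fscale)
  show ?thesis
    by (intro kspace.intro abelian_monoidI kspace_axioms.intro)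
      (auto simp: S_carrier S_zero algebra_simps fs.scale_right_distrib fs.scale_left_distrib)
qed

end

section \<open>Grading, sign changes and representations of S\<close>

lemma lookup_free_component:
  "Poly_Mapping.lookup (free_component n p) w = (if length (letters w) = n then Poly_Mapping.lookup p w else 0)"
  by (auto simp: free_component_def lookup_sum lookup_single when_def in_keys_iff)

lemma free_component_add [simp]: "free_component n (p + p') = free_component n p + free_component n p'"
  by (rule poly_mapping_eqI) (simp add: lookup_free_component lookup_add)

lemma free_component_diff [simp]: "free_component n (p - p') = free_component n p - free_component n p'"
  by (rule poly_mapping_eqI) (simp add: lookup_free_component lookup_minus)

lemma free_component_zero [simp]: "free_component n 0 = 0"
  by (rule poly_mapping_eqI) (simp add: lookup_free_component)

lemma free_component_fscale [simp]: "free_component n (fscale d p) = fscale d (free_component n p)"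
  by (rule poly_mapping_eqI) (simp add: lookup_free_component)

lemma free_component_single [simp]:
  "free_component n (Poly_Mapping.single w d) = (if length (letters w) = n then Poly_Mapping.single w d else 0)"
  by (rule poly_mapping_eqI) (simp add: lookup_free_component lookup_single when_def)

lemma length_letters_add [simp]: "length (letters (u + v)) = length (letters u) + length (letters v)"
  by (simp add: plus_monomial_def)

lemma free_component_mult_left:
  "free_component n (Poly_Mapping.single w d * p) =
    (if length (letters w) \<le> n then Poly_Mapping.single w d * free_component (n - length (letters w)) p else 0)"
  by (rule finsupp_induct[of p UNIV]) (auto simp: mult_single distrib_left)

lemma free_component_mult_right:
  "free_component n (p * Poly_Mapping.single w d) =
    (if length (letters w) \<le> n then free_component (n - length (letters w)) p * Poly_Mapping.single w d else 0)"
  by (rule finsupp_induct[of p UNIV]) (auto simp: mult_single distrib_right)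

definition word_sign :: "idx \<Rightarrow> monomial \<Rightarrow> 'k::field"
  where "word_sign g w = prod_list (map (gen_sign g) (letters w))"

lemma word_sign_add [simp]: "word_sign g (u + v) = word_sign g u * word_sign g v"
  by (simp add: word_sign_def plus_monomial_def)

lemma lookup_free_\<Gamma>: "Poly_Mapping.lookup (free_\<Gamma> g p) w = Poly_Mapping.lookup p w * word_sign g w"
  by (auto simp: free_\<Gamma>_def lookup_sum lookup_single when_def in_keys_iff word_sign_def)

lemma free_\<Gamma>_add [simp]: "free_\<Gamma> g (p + p') = free_\<Gamma> g p + free_\<Gamma> g p'"
  by (rule poly_mapping_eqI) (simp add: lookup_free_\<Gamma> lookup_add algebra_simps)

lemma free_\<Gamma>_diff [simp]: "free_\<Gamma> g (p - p') = free_\<Gamma> g p - free_\<Gamma> g p'"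
  by (rule poly_mapping_eqI) (simp add: lookup_free_\<Gamma> lookup_minus algebra_simps)

lemma free_\<Gamma>_zero [simp]: "free_\<Gamma> g 0 = 0"
  by (rule poly_mapping_eqI) (simp add: lookup_free_\<Gamma>)

lemma free_\<Gamma>_fscale [simp]: "free_\<Gamma> g (fscale d p) = fscale d (free_\<Gamma> g p)"
  by (rule poly_mapping_eqI) (simp add: lookup_free_\<Gamma>)

lemma free_\<Gamma>_single [simp]: "free_\<Gamma> g (Poly_Mapping.single w d) = Poly_Mapping.single w (d * word_sign g w)"
  by (rule poly_mapping_eqI) (simp add: lookup_free_\<Gamma> lookup_single when_def)

lemma free_\<Gamma>_mult_left:
  "free_\<Gamma> g (Poly_Mapping.single w d * p) = Poly_Mapping.single w (d * word_sign g w) * free_\<Gamma> g p"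
  by (rule finsupp_induct[of p UNIV]) (auto simp: mult_single distrib_left mult.assoc mult.left_commute)

lemma free_\<Gamma>_mult_right:
  "free_\<Gamma> g (p * Poly_Mapping.single w d) = free_\<Gamma> g p * Poly_Mapping.single w (d * word_sign g w)"
  by (rule finsupp_induct[of p UNIV]) (auto simp: mult_single distrib_right mult.assoc mult.left_commute)

definition free_act :: "(idx \<Rightarrow> 'k::field^2^2) \<Rightarrow> 'k free_alg \<Rightarrow> 'k^2 \<Rightarrow> 'k^2"
  where "free_act \<rho> p v = (\<Sum>w\<in>Poly_Mapping.keys p. Poly_Mapping.lookup p w *s monomial_act \<rho> w v)"

lemma monomial_act_linear [simp]:
  "monomial_act \<rho> w (v + v') = monomial_act \<rho> w v + monomial_act \<rho> w v'"
  "monomial_act \<rho> w (d *s v) = d *s monomial_act \<rho> w v"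
  "monomial_act \<rho> w 0 = 0"
proof -
  define l where "l = letters w"
  have "foldr (\<lambda>l. (*v) (\<rho> l)) l (v + v') = foldr (\<lambda>l. (*v) (\<rho> l)) l v + foldr (\<lambda>l. (*v) (\<rho> l)) l v'"
    "foldr (\<lambda>l. (*v) (\<rho> l)) l (d *s v) = d *s foldr (\<lambda>l. (*v) (\<rho> l)) l v"
    "foldr (\<lambda>l. (*v) (\<rho> l)) l 0 = 0"
    by (induction l) (simp_all add: matrix_vector_right_distrib vector_scalar_commute)
  then show "monomial_act \<rho> w (v + v') = monomial_act \<rho> w v + monomial_act \<rho> w v'"
    "monomial_act \<rho> w (d *s v) = d *s monomial_act \<rho> w v" "monomial_act \<rho> w 0 = 0"
    by (simp_all add: monomial_act_def l_def)
qed

lemma monomial_act_add [simp]: "monomial_act \<rho> (u + w) v = monomial_act \<rho> u (monomial_act \<rho> w v)"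
  by (simp add: monomial_act_def plus_monomial_def)

lemma free_act_add [simp]: "free_act \<rho> (p + p') v = free_act \<rho> p v + free_act \<rho> p' v"
  unfolding free_act_def
  by (rule setsum_keys_plus_distrib) (simp_all add: vector_sadd_rdistrib)

lemma free_act_zero [simp]: "free_act \<rho> 0 v = 0"
  by (simp add: free_act_def)

lemma free_act_single [simp]: "free_act \<rho> (Poly_Mapping.single w d) v = d *s monomial_act \<rho> w v"
  by (simp add: free_act_def)

lemma free_act_fscale [simp]: "free_act \<rho> (fscale d p) v = d *s free_act \<rho> p v"
proof -
  show ?thesis
    by (intro finsupp_induct[of p UNIV "\<lambda>p. free_act \<rho> (fscale d p) v = d *s free_act \<rho> p v"])
      (auto simp: vector_add_ldistrib vector_smult_assoc)
qed

lemma free_act_diff [simp]: "free_act \<rho> (p - p') v = free_act \<rho> p v - free_act \<rho> p' v"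
  using free_act_add[of \<rho> "p - p'" p' v] by (simp add: algebra_simps)

lemma free_act_linear [simp]:
  "free_act \<rho> p (v + v') = free_act \<rho> p v + free_act \<rho> p v'"
  "free_act \<rho> p (d *s v) = d *s free_act \<rho> p v"
  "free_act \<rho> p 0 = 0"
  by (simp_all add: free_act_def vector_add_ldistrib sum.distrib vector_smult_assoc mult.commute
      vec.scale_sum_right)

lemma free_act_mult_left:
  "free_act \<rho> (Poly_Mapping.single w d * p) v = d *s monomial_act \<rho> w (free_act \<rho> p v)"
  by (rule finsupp_induct[of p UNIV])
    (auto simp: mult_single distrib_left vector_add_ldistrib vector_smult_assoc)

lemma free_act_mult_right:
  "free_act \<rho> (p * Poly_Mapping.single w d) v = free_act \<rho> p (d *s monomial_act \<rho> w v)"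
  by (rule finsupp_induct[of p UNIV])
    (auto simp: mult_single distrib_right vector_smult_assoc mult.commute vector_add_ldistrib)

text \<open>
  The relations are homogeneous of degree 2, and multiplication by a term only shifts degrees.
\<close>

lemma S_ideal_component: "p \<in> S_ideal \<alpha> \<Longrightarrow> free_component n p \<in> S_ideal \<alpha>"
proof (induction p arbitrary: n rule: S_ideal_induct)
  case (relation r)
  then have "free_component n r = (if n = 2 then r else 0)"
    by (auto simp: S_relations_def xgen_def mult_single plus_monomial_def)
  then show ?case
    using relation by (simp add: S_ideal_relations S_ideal_zero)
qed (auto simp: free_component_mult_left free_component_mult_right
    intro: S_ideal_zero S_ideal_add S_ideal_mult_left S_ideal_mult_right)

text \<open>
  Each \<open>g\<close> multiplies \<open>x\<^sub>0 x\<^sub>i\<close> and \<open>x\<^sub>j x\<^sub>k\<close> by the same sign, and hence it acts on each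
  defining relation of \<open>S\<close> by a sign.
\<close>

lemma gen_sign_cyclic:
  "(i, j, k) \<in> cyclic \<Longrightarrow> gen_sign g j * gen_sign g k = (gen_sign g i :: 'k::field)"
  by (cases g) (auto simp: cyclic_def gen_sign_def)

lemma S_ideal_\<Gamma>: "p \<in> S_ideal \<alpha> \<Longrightarrow> free_\<Gamma> g p \<in> S_ideal \<alpha>"
proof (induction p rule: S_ideal_induct)
  case (relation r)
  have sign: "gen_sign g I0 = (1::'a)"
    by (simp add: gen_sign_def)
  have "\<exists>d. free_\<Gamma> g r = fscale d r"
    using relation unfolding S_relations_def
  proof (elim UnE CollectE exE conjE)
    fix i j k assume r: "r = xgen I0 * xgen i - xgen i * xgen I0 - fscale (\<alpha> i) (xgen j * xgen k + xgen k * xgen j)"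
      and cyc: "(i, j, k) \<in> cyclic"
    have "free_\<Gamma> g r = fscale (gen_sign g i) r"
      using gen_sign_cyclic[OF cyc, of g, where ?'k='a]
      by (simp add: r xgen_def mult_single plus_monomial_def word_sign_def sign mult.commute)
    then show ?thesis ..
  next
    fix i j k assume r: "r = xgen I0 * xgen i + xgen i * xgen I0 - (xgen j * xgen k - xgen k * xgen j)"
      and cyc: "(i, j, k) \<in> cyclic"
    have "free_\<Gamma> g r = fscale (gen_sign g i) r"
      using gen_sign_cyclic[OF cyc, of g, where ?'k='a]
      by (simp add: r xgen_def mult_single plus_monomial_def word_sign_def sign mult.commute)
    then show ?thesis ..
  qed
  then show ?case
    using S_ideal_fscale[OF S_ideal_relations[OF relation]] by auto
qed (auto simp: free_\<Gamma>_mult_left free_\<Gamma>_mult_right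
    intro: S_ideal_zero S_ideal_add S_ideal_mult_left S_ideal_mult_right)

lemma S_\<Gamma>_class [simp]: "S_\<Gamma> \<alpha> g (S_class \<alpha> p) = S_class \<alpha> (free_\<Gamma> g p)"
  using S_ideal_\<Gamma>[OF rep_S_class[of \<alpha> p], of g] by (simp add: S_\<Gamma>_def S_class_eq_iff)

lemma S_component_class [simp]: "S_component \<alpha> n (S_class \<alpha> p) = S_class \<alpha> (free_component n p)"
  using S_ideal_component[OF rep_S_class[of \<alpha> p], of n] by (simp add: S_component_def S_class_eq_iff)

lemma V_act_class:
  assumes "\<And>r v. r \<in> S_relations \<alpha> \<Longrightarrow> free_act \<rho> r v = 0"
  shows "V_act \<rho> (S_class \<alpha> p) v = free_act \<rho> p v"
proof -
  have "free_act \<rho> p v = 0" if "p \<in> S_ideal \<alpha>" for p v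
    using that
    by (induction p arbitrary: v rule: S_ideal_induct)
      (simp_all add: assms free_act_mult_left free_act_mult_right)
  from this[OF rep_S_class[of \<alpha> p]] have "free_act \<rho> (rep (S_class \<alpha> p)) v = free_act \<rho> p v"
    by simp
  then show ?thesis
    by (simp add: V_act_def free_act_def)
qed

section \<open>The vector spaces in the statement\<close>

lemma k2_simps [simp]:
  "carrier k2 = UNIV" "\<zero>\<^bsub>k2\<^esub> = 0" "u \<oplus>\<^bsub>k2\<^esub> v = u + v" "c \<odot>\<^bsub>k2\<^esub> v = c *s v"
  by (simp_all add: k2_def)

lemma kt_simps [simp]:
  "carrier kt = UNIV" "\<zero>\<^bsub>kt\<^esub> = 0" "r \<oplus>\<^bsub>kt\<^esub> r' = r + r'" "c \<odot>\<^bsub>kt\<^esub> r = Polynomial.smult c r"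
  by (simp_all add: kt_def)

lemma M2_simps [simp]:
  "carrier M2 = UNIV" "\<zero>\<^bsub>M2\<^esub> = 0" "A \<oplus>\<^bsub>M2\<^esub> B = A + B" "c \<odot>\<^bsub>M2\<^esub> A = mscale c A"
  by (simp_all add: M2_def)

lemma mscale_simps [simp]:
  "mscale c A $ r $ s = c * A $ r $ s" "mscale 1 A = A" "mscale 0 A = 0" "mscale c 0 = 0"
  "mscale c (mscale d A) = mscale (c * d) A"
  by (simp_all add: mscale_def vec_eq_iff)

lemma mscale_add: "mscale c (A + B) = mscale c A + mscale c B"
  "mscale (c + d) A = mscale c A + mscale d A"
  by (simp_all add: vec_eq_iff algebra_simps)

lemma mscale_mult:
  "mscale c A ** B = mscale c (A ** B)" "A ** mscale c B = mscale c (A ** B)"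
  for A B :: "'k::field^2^2"
  by (simp_all add: vec_eq_iff matrix_matrix_mult_def sum_distrib_left mult.assoc mult.left_commute)

lemma mat2_distrib: "A ** (B + C) = A ** B + A ** C" "(A + B) ** C = A ** C + B ** C"
  for A B C :: "'k::field^2^2"
  by (simp_all add: vec_eq_iff matrix_matrix_mult_def algebra_simps sum.distrib)

lemma transpose_mscale: "transpose (mscale c A) = mscale c (transpose A)"
  by (simp add: vec_eq_iff transpose_def)

lemma kspace_k2: "kspace (k2 :: ('k::field, 'k^2) module)"
  by (intro kspace.intro abelian_monoidI kspace_axioms.intro)
    (simp_all add: algebra_simps vector_add_ldistrib vector_sadd_rdistrib vector_smult_assoc)

lemma kspace_kt: "kspace (kt :: ('k::field, 'k poly) module)"
  by (intro kspace.intro abelian_monoidI kspace_axioms.intro)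
    (simp_all add: algebra_simps smult_add_right smult_add_left)

lemma kspace_M2: "kspace (M2 :: ('k::field, 'k^2^2) module)"
  by (intro kspace.intro abelian_monoidI kspace_axioms.intro) (simp_all add: algebra_simps mscale_add)

lemma kspace_F: "kspace F"
  unfolding F_def by (rule kspace_tensor_space)

lemma kspace_FK: "kspace FK"
  unfolding FK_def by (rule kspace_tensor_space)

abbreviation pureF :: "'k::field^2 \<Rightarrow> 'k poly \<Rightarrow> 'k Fvec"
  where "pureF \<equiv> pure_tensor k2 kt"

abbreviation pureFK :: "'k::field Fvec \<Rightarrow> 'k^2 \<Rightarrow> 'k FKvec"
  where "pureFK \<equiv> pure_tensor F k2"

lemma kbilinear_pureF: "kbilinear k2 kt F pureF"
  unfolding F_def by (rule kbilinear_pure_tensor)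

lemma kbilinear_pureFK: "kbilinear F k2 FK pureFK"
  unfolding FK_def by (rule kbilinear_pure_tensor)

lemmas pureF_rules [simp] = kbilinearD[OF kbilinear_pureF, simplified]
lemmas pureFK_rules [simp] = kbilinearD[OF kbilinear_pureFK, simplified]

lemma pureF_zero [simp]: "pureF 0 r = \<zero>\<^bsub>F\<^esub>"
proof -
  have "klinear k2 F (\<lambda>v. pureF v r)"
    by (rule kbilinear_left[OF kbilinear_pureF]) simp
  from klinear_zero[OF this kspace_k2 kspace_F] show ?thesis
    by simp
qed

lemma klinear_F_eqI:
  assumes "klinear F U f" and "klinear F U g" and "\<And>v r. f (pureF v r) = g (pureF v r)"
    and "X \<in> carrier F"
  shows "f X = g X"
  by (rule klinear_tensor_eqI[OF assms(1,2)[unfolded F_def] _ kspace_k2 kspace_kt assms(4)[unfolded F_def]])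
    (rule assms(3))

lemma klinear_FK_eqI:
  assumes "klinear FK U f" and "klinear FK U g"
    and "\<And>x u. x \<in> carrier F \<Longrightarrow> f (pureFK x u) = g (pureFK x u)"
    and "X \<in> carrier FK"
  shows "f X = g X"
  by (rule klinear_tensor_eqI[OF assms(1,2)[unfolded FK_def] _ kspace_F kspace_k2 assms(4)[unfolded FK_def]])
    (rule assms(3))

lemma klinear_kt_eqI:
  assumes f: "klinear kt U f" and g: "klinear kt U g"
    and eq: "\<And>n. f (Polynomial.monom 1 n) = g (Polynomial.monom 1 n)"
  shows "f r = g r"
proof -
  note f' = klinearD[OF f, simplified] and g' = klinearD[OF g, simplified]
  have monom: "f (Polynomial.monom c n) = g (Polynomial.monom c n)" for c n
    using f'(3)[of c "Polynomial.monom 1 n"] g'(3)[of c "Polynomial.monom 1 n"] eq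
    by (simp add: smult_monom)
  have "f (\<Sum>i\<le>N. Polynomial.monom (coeff r i) i) = g (\<Sum>i\<le>N. Polynomial.monom (coeff r i) i)" for N
    by (induction N) (simp_all add: f' g' monom)
  from this[of "degree r"] show ?thesis
    by (simp add: poly_as_sum_of_monoms)
qed

text \<open>
  \<open>F \<otimes> k\<^sup>2\<close> is spanned by the \<open>(v \<otimes> t\<^sup>n) \<otimes> u\<close>.
\<close>

lemma klinear_FK_eqI_monom:
  fixes U :: "('k::field, 'u) module"
  assumes f: "klinear FK U f" and g: "klinear FK U g"
    and eq: "\<And>v n u. f (pureFK (pureF v (Polynomial.monom 1 n)) u) = g (pureFK (pureF v (Polynomial.monom 1 n)) u)"
    and X: "X \<in> carrier FK"
  shows "f X = g X"
proof (rule klinear_FK_eqI[OF f g _ X])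
  fix x :: "'k Fvec" and u :: "'k^2" assume x: "x \<in> carrier F"
  have u: "klinear F FK (\<lambda>x. pureFK x u)"
    by (rule kbilinear_left[OF kbilinear_pureFK]) simp
  show "f (pureFK x u) = g (pureFK x u)"
  proof (rule klinear_F_eqI[OF klinear_compose[OF u f] klinear_compose[OF u g] _ x])
    fix v :: "'k^2" and r :: "'k poly"
    have v: "klinear kt F (pureF v)"
      by (rule kbilinear_right[OF kbilinear_pureF]) simp
    show "f (pureFK (pureF v r) u) = g (pureFK (pureF v r) u)"
      by (rule klinear_kt_eqI[OF klinear_compose[OF v klinear_compose[OF u f]]
            klinear_compose[OF v klinear_compose[OF u g]]]) (rule eq)
  qed
qed

section \<open>The actions of S and S'\<close>

locale S_rep =
  fixes \<alpha> :: "idx \<Rightarrow> 'k::field" and \<rho> :: "idx \<Rightarrow> 'k^2^2"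
  assumes relations: "r \<in> S_relations \<alpha> \<Longrightarrow> free_act \<rho> r v = 0"
begin

lemma V_act_S_class [simp]: "V_act \<rho> (S_class \<alpha> p) v = free_act \<rho> p v"
  using relations by (rule V_act_class)

text \<open>
  The action of \<open>s\<close> on \<open>v \<otimes> r\<close>. The degrees that occur in the sum depend on \<open>s\<close>; over a fixed range
  \<open>{..N}\<close>, as in \<open>F_term_class\<close>, the sum is visibly linear in \<open>s\<close>.
\<close>

definition F_term :: "'k free_alg set \<Rightarrow> 'k^2 \<Rightarrow> 'k poly \<Rightarrow> 'k Fvec"
  where "F_term s v r = (\<Oplus>\<^bsub>F\<^esub>n\<in>{n. S_component \<alpha> n s \<noteq> \<zero>\<^bsub>S \<alpha>\<^esub>}.
      pureF (V_act \<rho> (S_component \<alpha> n s) v) (Polynomial.monom 1 n * r))"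

interpretation F: kspace F by (rule kspace_F)
interpretation FK: kspace FK by (rule kspace_FK)

lemma F_term_class:
  assumes N: "\<forall>w\<in>Poly_Mapping.keys p. length (letters w) \<le> N"
  shows "F_term (S_class \<alpha> p) = (\<lambda>v r.
    \<Oplus>\<^bsub>F\<^esub>n\<in>{..N}. pureF (free_act \<rho> (free_component n p) v) (Polynomial.monom 1 n * r))"
proof (intro ext)
  fix v r
  have large: "free_component n p = 0" if "n > N" for n
  proof (rule poly_mapping_eqI)
    fix w show "Poly_Mapping.lookup (free_component n p) w = Poly_Mapping.lookup 0 w"
      using N that
      by (cases "w \<in> Poly_Mapping.keys p")
        (auto simp: lookup_free_component not_in_keys_iff_lookup_eq_zero)
  qed
  have zero: "free_act \<rho> (free_component n p) v = 0" if "S_class \<alpha> (free_component n p) = S_class \<alpha> 0" for n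
    using that V_act_S_class[of "free_component n p" v] by simp
  show "F_term (S_class \<alpha> p) v r =
      (\<Oplus>\<^bsub>F\<^esub>n\<in>{..N}. pureF (free_act \<rho> (free_component n p) v) (Polynomial.monom 1 n * r))"
    unfolding F_term_def
    by (rule F.add.finprod_mono_neutral_cong_left)
      (use large in \<open>auto simp: S_zero zero not_le[symmetric]\<close>)
qed

text \<open>
  The bound gives a range of degrees over which an element, or two elements and their sum, can be expanded.
\<close>

lemma finite_word_bound: "\<exists>N. \<forall>w\<in>Poly_Mapping.keys (p :: 'k free_alg). length (letters w) \<le> N"
proof -
  have "finite ((\<lambda>w. length (letters w)) ` Poly_Mapping.keys p)"
    by simp
  then show ?thesis
    unfolding finite_nat_set_iff_bounded_le by simp
qed

lemma kbilinear_F_term: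
  assumes "s \<in> carrier (S \<alpha>)"
  shows "kbilinear k2 kt F (F_term s)"
proof -
  obtain p where p: "s = S_class \<alpha> p"
    using assms by (auto simp: S_carrier)
  obtain N where N: "\<forall>w\<in>Poly_Mapping.keys p. length (letters w) \<le> N"
    using finite_word_bound[of p] by blast
  have "klinear kt F (F_term s v)" for v
    unfolding p F_term_class[OF N]
    by (rule klinear_finsum_fun)
      (auto intro!: klinearI kspace_F simp: distrib_left mult_smult_right)
  moreover have "klinear k2 F (\<lambda>v. F_term s v r)" for r
    unfolding p F_term_class[OF N]
    by (rule klinear_finsum_fun) (auto intro!: klinearI kspace_F)
  ultimately show ?thesis
    by (simp add: kbilinear_def)
qed

lemma klinear_F_term: "klinear (S \<alpha>) F (\<lambda>s. F_term s v r)"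
proof (rule klinearI)
  fix s assume s: "s \<in> carrier (S \<alpha>)"
  then show "F_term s v r \<in> carrier F"
    using kbilinearD(1)[OF kbilinear_F_term] by simp
  obtain p where p: "s = S_class \<alpha> p"
    using s by (auto simp: S_carrier)
  obtain N where N: "\<forall>w\<in>Poly_Mapping.keys p. length (letters w) \<le> N"
    using finite_word_bound[of p] by blast
  fix d
  have Nd: "\<forall>w\<in>Poly_Mapping.keys (fscale d p). length (letters w) \<le> N"
    using N by (auto simp: in_keys_iff)
  show "F_term (d \<odot>\<^bsub>S \<alpha>\<^esub> s) v r = d \<odot>\<^bsub>F\<^esub> F_term s v r"
    unfolding p S_smult F_term_class[OF N] F_term_class[OF Nd]
    by (subst F.finsum_smult[symmetric]) simp_all
next
  fix s s' assume "s \<in> carrier (S \<alpha>)" "s' \<in> carrier (S \<alpha>)"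
  then obtain p p' where p: "s = S_class \<alpha> p" "s' = S_class \<alpha> p'"
    by (auto simp: S_carrier)
  obtain N where N: "\<forall>w\<in>Poly_Mapping.keys p. length (letters w) \<le> N"
    using finite_word_bound[of p] by blast
  obtain N' where N': "\<forall>w\<in>Poly_Mapping.keys p'. length (letters w) \<le> N'"
    using finite_word_bound[of p'] by blast
  define M where "M = max N N'"
  have M: "\<forall>w\<in>Poly_Mapping.keys p. length (letters w) \<le> M"
    "\<forall>w\<in>Poly_Mapping.keys p'. length (letters w) \<le> M"
    using N N' by (auto simp: M_def)
  have M2: "\<forall>w\<in>Poly_Mapping.keys (p + p'). length (letters w) \<le> M"
    using M keys_add[of p p'] by blast
  show "F_term (s \<oplus>\<^bsub>S \<alpha>\<^esub> s') v r = F_term s v r \<oplus>\<^bsub>F\<^esub> F_term s' v r"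
    unfolding p S_add F_term_class[OF M(1)] F_term_class[OF M(2)] F_term_class[OF M2]
    by (subst F.finsum_addf[symmetric]) simp_all
qed

lemma F_act_eq_lift: "F_act \<alpha> \<rho> s = tensor_lift F (F_term s)"
  by (simp add: F_act_def F_term_def[abs_def])

lemma F_act_pure [simp]:
  assumes "s \<in> carrier (S \<alpha>)"
  shows "F_act \<alpha> \<rho> s (pureF v r) = F_term s v r"
  using tensor_lift_pure[OF kspace_k2 kspace_kt kspace_F kbilinear_F_term[OF assms]]
  by (simp add: F_act_eq_lift)

lemma kbilinear_F_act: "kbilinear (S \<alpha>) F F (F_act \<alpha> \<rho>)"
  unfolding kbilinear_def
proof (intro conjI ballI)
  show lin: "klinear F F (F_act \<alpha> \<rho> s)" if "s \<in> carrier (S \<alpha>)" for s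
    using klinear_tensor_lift[OF kspace_k2 kspace_kt kspace_F kbilinear_F_term[OF that]]
    unfolding F_act_eq_lift F_def .
  interpret S: kspace "S \<alpha>" by (rule kspace_S)
  note t = klinearD[OF klinear_F_term]
  fix x :: "'k Fvec" assume x: "x \<in> carrier F"
  show "klinear (S \<alpha>) F (\<lambda>s. F_act \<alpha> \<rho> s x)"
  proof (rule klinearI)
    fix s assume s: "s \<in> carrier (S \<alpha>)"
    show "F_act \<alpha> \<rho> s x \<in> carrier F"
      using klinearD(1)[OF lin[OF s] x] .
    show "F_act \<alpha> \<rho> (d \<odot>\<^bsub>S \<alpha>\<^esub> s) x = d \<odot>\<^bsub>F\<^esub> F_act \<alpha> \<rho> s x" for d
      by (rule klinear_F_eqI[OF lin klinear_smult_fun[OF lin kspace_F] _ x]) (use s t in auto)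
    fix s' assume s': "s' \<in> carrier (S \<alpha>)"
    show "F_act \<alpha> \<rho> (s \<oplus>\<^bsub>S \<alpha>\<^esub> s') x = F_act \<alpha> \<rho> s x \<oplus>\<^bsub>F\<^esub> F_act \<alpha> \<rho> s' x"
      by (rule klinear_F_eqI[OF lin klinear_add_fun[OF lin lin kspace_F] _ x]) (use s s' t in auto)
  qed
qed

lemma F_act_word:
  "F_act \<alpha> \<rho> (S_class \<alpha> (gen w)) (pureF v r) =
    pureF (monomial_act \<rho> w v) (Polynomial.monom 1 (length (letters w)) * r)"
proof -
  let ?f = "\<lambda>n. pureF (monomial_act \<rho> w v) (Polynomial.monom 1 n * r)"
  have "F_act \<alpha> \<rho> (S_class \<alpha> (gen w)) (pureF v r) =
      (\<Oplus>\<^bsub>F\<^esub>n\<in>{..length (letters w)}. if length (letters w) = n then ?f n else \<zero>\<^bsub>F\<^esub>)"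
  proof -
    have N: "\<forall>w'\<in>Poly_Mapping.keys (gen w :: 'k free_alg). length (letters w') \<le> length (letters w)"
      by simp
    show ?thesis
      unfolding F_act_pure[OF S_class_carrier] F_term_class[OF N]
      by (rule F.finsum_cong'[OF refl]) auto
  qed
  also have "\<dots> = ?f (length (letters w))"
    by (rule F.finsum_singleton) auto
  finally show ?thesis .
qed

definition FK_pure_act :: "'k free_alg set \<Rightarrow> 'k^2^2 \<Rightarrow> 'k FKvec \<Rightarrow> 'k FKvec"
  where "FK_pure_act s m = tensor_lift FK (\<lambda>x u. pureFK (F_act \<alpha> \<rho> s x) (m *v u))"

lemma klinear_mult_vec: "klinear k2 k2 ((*v) m)"
  by (rule klinearI) (simp_all add: matrix_vector_right_distrib vector_scalar_commute)

lemma kbilinear_FK_pure_act: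
  assumes "s \<in> carrier (S \<alpha>)"
  shows "kbilinear F k2 FK (\<lambda>x u. pureFK (F_act \<alpha> \<rho> s x) (m *v u))"
  using kbilinear_F_act assms
  by (intro kbilinear_compose[OF kbilinear_pureFK _ klinear_mult_vec]) (simp add: kbilinear_def)

lemma klinear_FK_pure_act:
  assumes "s \<in> carrier (S \<alpha>)"
  shows "klinear FK FK (FK_pure_act s m)"
  using klinear_tensor_lift[OF kspace_F kspace_k2 kspace_FK kbilinear_FK_pure_act[OF assms]]
  unfolding FK_pure_act_def FK_def .

lemma FK_pure_act_pure:
  assumes "s \<in> carrier (S \<alpha>)" and "x \<in> carrier F"
  shows "FK_pure_act s m (pureFK x u) = pureFK (F_act \<alpha> \<rho> s x) (m *v u)"
  using tensor_lift_pure[OF kspace_F kspace_k2 kspace_FK kbilinear_FK_pure_act[OF assms(1)] assms(2)]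
  by (simp add: FK_pure_act_def)

lemma kbilinear_FK_pure_act_SM:
  assumes Y: "Y \<in> carrier FK"
  shows "kbilinear (S \<alpha>) M2 FK (\<lambda>s m. FK_pure_act s m Y)"
proof -
  interpret S: kspace "S \<alpha>" by (rule kspace_S)
  note lin = klinear_FK_pure_act and a = kbilinearD[OF kbilinear_F_act]
  have mscale_vec: "mscale d m *v u = d *s (m *v u)" for d m and u :: "'k^2"
    by (simp add: vec_eq_iff matrix_vector_mult_def sum_distrib_left mult.assoc)
  show ?thesis
  proof (rule kbilinearI)
    fix s m assume s: "s \<in> carrier (S \<alpha>)"
    show "FK_pure_act s m Y \<in> carrier FK"
      using klinearD(1)[OF lin[OF s] Y] .
    show "FK_pure_act (d \<odot>\<^bsub>S \<alpha>\<^esub> s) m Y = d \<odot>\<^bsub>FK\<^esub> FK_pure_act s m Y" for d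
      by (rule klinear_FK_eqI[OF lin klinear_smult_fun[OF lin kspace_FK] _ Y])
        (use s in \<open>auto simp: FK_pure_act_pure a\<close>)
    show "FK_pure_act s (d \<odot>\<^bsub>M2\<^esub> m) Y = d \<odot>\<^bsub>FK\<^esub> FK_pure_act s m Y" for d
      by (rule klinear_FK_eqI[OF lin klinear_smult_fun[OF lin kspace_FK] _ Y])
        (use s in \<open>auto simp: FK_pure_act_pure a mscale_vec\<close>)
    show "FK_pure_act s (m \<oplus>\<^bsub>M2\<^esub> m') Y = FK_pure_act s m Y \<oplus>\<^bsub>FK\<^esub> FK_pure_act s m' Y" for m'
      by (rule klinear_FK_eqI[OF lin klinear_add_fun[OF lin lin kspace_FK] _ Y])
        (use s in \<open>auto simp: FK_pure_act_pure a matrix_vector_mult_add_rdistrib\<close>)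
    fix s' assume s': "s' \<in> carrier (S \<alpha>)"
    show "FK_pure_act (s \<oplus>\<^bsub>S \<alpha>\<^esub> s') m Y = FK_pure_act s m Y \<oplus>\<^bsub>FK\<^esub> FK_pure_act s' m Y"
      by (rule klinear_FK_eqI[OF lin klinear_add_fun[OF lin lin kspace_FK] _ Y])
        (use s s' in \<open>auto simp: FK_pure_act_pure a\<close>)
  qed
qed

lemma FK_act_eq_lift: "FK_act \<alpha> \<rho> X Y = tensor_lift FK (\<lambda>s m. FK_pure_act s m Y) X"
  by (simp add: FK_act_def FK_pure_act_def)

lemma FK_act_pure:
  assumes "s \<in> carrier (S \<alpha>)" and "Y \<in> carrier FK"
  shows "FK_act \<alpha> \<rho> (pure_tensor (S \<alpha>) M2 s m) Y = FK_pure_act s m Y"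
  using tensor_lift_pure[OF kspace_S kspace_M2 kspace_FK kbilinear_FK_pure_act_SM[OF assms(2)] assms(1)]
  by (simp add: FK_act_eq_lift)

lemma klinear_FK_act_left:
  assumes "Y \<in> carrier FK"
  shows "klinear (tensor_space (S \<alpha>) M2) FK (\<lambda>X. FK_act \<alpha> \<rho> X Y)"
  unfolding FK_act_eq_lift
  by (rule klinear_tensor_lift[OF kspace_S kspace_M2 kspace_FK kbilinear_FK_pure_act_SM[OF assms]])

lemma klinear_FK_act_right:
  assumes "X \<in> carrier (tensor_space (S \<alpha>) M2)"
  shows "klinear FK FK (FK_act \<alpha> \<rho> X)"
  using assms
proof (induction X rule: tensor_space_induct)
  case (pure s m)
  then show ?case
    by (intro klinear_cong[OF klinear_FK_pure_act kspace_FK]) (auto simp: FK_act_pure)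
next
  case (add X Y)
  then show ?case
    by (intro klinear_cong[OF klinear_add_fun[OF add(3,4) kspace_FK] kspace_FK])
      (simp add: klinearD[OF klinear_FK_act_left])
next
  case (smult d X)
  then show ?case
    by (intro klinear_cong[OF klinear_smult_fun[OF smult(2) kspace_FK] kspace_FK])
      (simp add: klinearD[OF klinear_FK_act_left])
qed (auto simp: S_carrier)

end

lemma S'_simps [simp]:
  "carrier (S' \<alpha>) = carrier (tensor_space (S \<alpha>) M2)" "\<zero>\<^bsub>S' \<alpha>\<^esub> = \<zero>\<^bsub>tensor_space (S \<alpha>) M2\<^esub>"
  "add (S' \<alpha>) = add (tensor_space (S \<alpha>) M2)" "module.smult (S' \<alpha>) = module.smult (tensor_space (S \<alpha>) M2)"
  by (simp_all add: S'_def tensor_algebra_def)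

lemma kspace_S': "kspace (S' \<alpha>)"
  by (rule kspace_cong[OF kspace_tensor_space]) simp_all

lemma M2_\<Gamma>_linear: "klinear M2 M2 (M2_\<Gamma> i g)"
  by (rule klinearI) (simp_all add: M2_\<Gamma>_def mat2_distrib mscale_mult)

lemma S_\<Gamma>_linear: "klinear (S \<alpha>) (S \<alpha>) (S_\<Gamma> \<alpha> g)"
  by (rule klinearI) (auto simp: S_carrier)

lemma kbilinear_S'_\<Gamma>:
  "kbilinear (S \<alpha>) M2 (S' \<alpha>) (\<lambda>s m. pure_tensor (S \<alpha>) M2 (S_\<Gamma> \<alpha> g s) (M2_\<Gamma> i g m))"
proof -
  have "kbilinear (S \<alpha>) M2 (tensor_space (S \<alpha>) M2) (\<lambda>s m. pure_tensor (S \<alpha>) M2 (S_\<Gamma> \<alpha> g s) (M2_\<Gamma> i g m))"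
    by (rule kbilinear_compose[OF kbilinear_pure_tensor S_\<Gamma>_linear M2_\<Gamma>_linear])
  then show ?thesis
    by (simp add: kbilinear_def klinear_def)
qed

lemma klinear_S'_\<Gamma>: "klinear (tensor_space (S \<alpha>) M2) (tensor_space (S \<alpha>) M2) (S'_\<Gamma> \<alpha> i g)"
proof -
  have "klinear (tensor_space (S \<alpha>) M2) (S' \<alpha>) (S'_\<Gamma> \<alpha> i g)"
    unfolding S'_\<Gamma>_def by (rule klinear_tensor_lift[OF kspace_S kspace_M2 kspace_S' kbilinear_S'_\<Gamma>])
  then show ?thesis
    by (simp add: klinear_def)
qed

lemma S'_\<Gamma>_word:
  "S'_\<Gamma> \<alpha> i g (pure_tensor (S \<alpha>) M2 (S_class \<alpha> (gen w)) m) =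
    word_sign g w \<odot>\<^bsub>tensor_space (S \<alpha>) M2\<^esub> pure_tensor (S \<alpha>) M2 (S_class \<alpha> (gen w)) (M2_\<Gamma> i g m)"
proof -
  have "S'_\<Gamma> \<alpha> i g (pure_tensor (S \<alpha>) M2 (S_class \<alpha> (gen w)) m) =
      pure_tensor (S \<alpha>) M2 (S_class \<alpha> (free_\<Gamma> g (gen w))) (M2_\<Gamma> i g m)"
    unfolding S'_\<Gamma>_def by (subst tensor_lift_pure[OF kspace_S kspace_M2 kspace_S' kbilinear_S'_\<Gamma>]) simp_all
  also have "S_class \<alpha> (free_\<Gamma> g (gen w)) = word_sign g w \<odot>\<^bsub>S \<alpha>\<^esub> S_class \<alpha> (gen w)"
    by simp
  finally show ?thesis
    by (simp only: kbilinearD(4)[OF kbilinear_pure_tensor] S_class_carrier M2_simps UNIV_I)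
qed

text \<open>
  \<open>S'\<close> is spanned by the \<open>w \<otimes> m\<close> with \<open>w\<close> a word in the generators.
\<close>

lemma klinear_S'_eqI:
  assumes f: "klinear (tensor_space (S \<alpha>) M2) U f" and g: "klinear (tensor_space (S \<alpha>) M2) U g"
    and eq: "\<And>w m. f (pure_tensor (S \<alpha>) M2 (S_class \<alpha> (gen w)) m) = g (pure_tensor (S \<alpha>) M2 (S_class \<alpha> (gen w)) m)"
    and X: "X \<in> carrier (tensor_space (S \<alpha>) M2)"
  shows "f X = g X"
proof (rule klinear_tensor_eqI[OF f g _ kspace_S kspace_M2 X])
  fix s :: "'a free_alg set" and m :: "'a^2^2" assume "s \<in> carrier (S \<alpha>)"
  then obtain p where p: "s = S_class \<alpha> p"
    by (auto simp: S_carrier)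
  have m: "klinear (S \<alpha>) (tensor_space (S \<alpha>) M2) (\<lambda>s. pure_tensor (S \<alpha>) M2 s m)"
    by (rule kbilinear_left[OF kbilinear_pure_tensor]) simp
  note f' = klinearD[OF klinear_compose[OF m f]] and g' = klinearD[OF klinear_compose[OF m g]]
  have single: "f (pure_tensor (S \<alpha>) M2 (S_class \<alpha> (Poly_Mapping.single w d)) m) =
      g (pure_tensor (S \<alpha>) M2 (S_class \<alpha> (Poly_Mapping.single w d)) m)" for w d
    using f'(3)[OF S_class_carrier, of d "gen w"] g'(3)[OF S_class_carrier, of d "gen w"] eq by simp
  have "f (pure_tensor (S \<alpha>) M2 (S_class \<alpha> p) m) = g (pure_tensor (S \<alpha>) M2 (S_class \<alpha> p) m)"
  proof (rule finsupp_induct[of p UNIV])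
    show "f (pure_tensor (S \<alpha>) M2 (S_class \<alpha> 0) m) = g (pure_tensor (S \<alpha>) M2 (S_class \<alpha> 0) m)"
      using single[of _ 0] by simp
    fix p q
    assume "f (pure_tensor (S \<alpha>) M2 (S_class \<alpha> p) m) = g (pure_tensor (S \<alpha>) M2 (S_class \<alpha> p) m)"
      "f (pure_tensor (S \<alpha>) M2 (S_class \<alpha> q) m) = g (pure_tensor (S \<alpha>) M2 (S_class \<alpha> q) m)"
    then show "f (pure_tensor (S \<alpha>) M2 (S_class \<alpha> (p + q)) m) = g (pure_tensor (S \<alpha>) M2 (S_class \<alpha> (p + q)) m)"
      using f'(2)[OF S_class_carrier S_class_carrier, of p q] g'(2)[OF S_class_carrier S_class_carrier, of p q]
      by simp
  qed (simp_all add: single)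
  then show "f (pure_tensor (S \<alpha>) M2 s m) = g (pure_tensor (S \<alpha>) M2 s m)"
    by (simp add: p)
qed

section \<open>Polynomials with matrix coefficients\<close>

definition vec_polys :: "('k::field, ('k^2) poly) module"
  where "vec_polys = \<lparr>carrier = UNIV, monoid.mult = undefined, one = undefined, ring.zero = 0, add = (+),
    module.smult = (\<lambda>c. map_poly ((*s) c))\<rparr>"

definition mat_polys :: "('k::field, ('k^2^2) poly) module"
  where "mat_polys = \<lparr>carrier = UNIV, monoid.mult = undefined, one = undefined, ring.zero = 0, add = (+),
    module.smult = (\<lambda>c. map_poly (mscale c))\<rparr>"

lemma vec_polys_simps [simp]:
  "carrier vec_polys = UNIV" "\<zero>\<^bsub>vec_polys\<^esub> = 0" "p \<oplus>\<^bsub>vec_polys\<^esub> p' = p + p'"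
  "c \<odot>\<^bsub>vec_polys\<^esub> p = map_poly ((*s) c) p"
  by (simp_all add: vec_polys_def)

lemma mat_polys_simps [simp]:
  "carrier mat_polys = UNIV" "\<zero>\<^bsub>mat_polys\<^esub> = 0" "p \<oplus>\<^bsub>mat_polys\<^esub> p' = p + p'"
  "c \<odot>\<^bsub>mat_polys\<^esub> p = map_poly (mscale c) p"
  by (simp_all add: mat_polys_def)

lemma kspace_vec_polys: "kspace (vec_polys :: ('k::field, ('k^2) poly) module)"
  by (intro kspace.intro abelian_monoidI kspace_axioms.intro)
    (auto intro!: poly_eqI simp: coeff_map_poly algebra_simps vector_add_ldistrib vector_sadd_rdistrib
      vector_smult_assoc)

lemma kspace_mat_polys: "kspace (mat_polys :: ('k::field, ('k^2^2) poly) module)"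
  by (intro kspace.intro abelian_monoidI kspace_axioms.intro)
    (auto intro!: poly_eqI simp: coeff_map_poly algebra_simps mscale_add)

text \<open>
  The matrix \<open>v u\<^sup>T\<close>, which stands for \<open>v \<otimes> u\<close>.
\<close>

definition outer :: "'k::field^2 \<Rightarrow> 'k^2 \<Rightarrow> 'k^2^2"
  where "outer v u = (\<chi> r s. v $ r * u $ s)"

lemma outer_zero [simp]: "outer 0 u = 0" "outer v 0 = 0"
  by (simp_all add: outer_def vec_eq_iff)

lemma outer_linear:
  "outer (v + v') u = outer v u + outer v' u" "outer v (u + u') = outer v u + outer v u'"
  "outer (c *s v) u = mscale c (outer v u)" "outer v (c *s u) = mscale c (outer v u)"
  by (simp_all add: outer_def vec_eq_iff algebra_simps)

lemma outer_rows: "outer (axis 1 1) (A $ 1) + outer (axis 2 1) (A $ 2) = A" for A :: "'k::field^2^2"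
  by (simp add: outer_def vec_eq_iff forall_2 axis_def)

definition F_to_poly :: "'k::field Fvec \<Rightarrow> ('k^2) poly"
  where "F_to_poly = tensor_lift vec_polys (\<lambda>v. map_poly (\<lambda>x. x *s v))"

text \<open>
  The isomorphism from \<open>F \<otimes> k\<^sup>2\<close> to \<open>M\<^sub>2(k)[t]\<close> that sends \<open>(v \<otimes> t\<^sup>n) \<otimes> u\<close> to \<open>v u\<^sup>T t\<^sup>n\<close>.
\<close>

definition to_poly :: "'k::field FKvec \<Rightarrow> ('k^2^2) poly"
  where "to_poly = tensor_lift mat_polys (\<lambda>x u. map_poly (\<lambda>v. outer v u) (F_to_poly x))"

lemma kbilinear_F_to_poly: "kbilinear k2 kt vec_polys (\<lambda>v. map_poly (\<lambda>x. x *s v))"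
  by (rule kbilinearI) (auto intro!: poly_eqI simp: coeff_map_poly vector_add_ldistrib
      vector_sadd_rdistrib vector_smult_assoc mult.commute)

lemma klinear_F_to_poly: "klinear F vec_polys F_to_poly"
  unfolding F_to_poly_def F_def
  by (rule klinear_tensor_lift[OF kspace_k2 kspace_kt kspace_vec_polys kbilinear_F_to_poly])

lemma F_to_poly_pure: "F_to_poly (pureF v r) = map_poly (\<lambda>x. x *s v) r"
  unfolding F_to_poly_def
  by (subst tensor_lift_pure[OF kspace_k2 kspace_kt kspace_vec_polys kbilinear_F_to_poly]) simp_all

lemma kbilinear_to_poly: "kbilinear F k2 mat_polys (\<lambda>x u. map_poly (\<lambda>v. outer v u) (F_to_poly x))"
  by (rule kbilinearI)
    (auto intro!: poly_eqI simp: coeff_map_poly outer_linear klinearD[OF klinear_F_to_poly])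

lemma klinear_to_poly: "klinear FK mat_polys to_poly"
  unfolding to_poly_def FK_def
  by (rule klinear_tensor_lift[OF kspace_F kspace_k2 kspace_mat_polys kbilinear_to_poly])

lemma to_poly_pure:
  "to_poly (pureFK (pureF v (Polynomial.monom 1 n)) u) = Polynomial.monom (outer v u) n"
proof -
  have "to_poly (pureFK (pureF v (Polynomial.monom 1 n)) u) =
      map_poly (\<lambda>v. outer v u) (F_to_poly (pureF v (Polynomial.monom 1 n)))"
    unfolding to_poly_def
    by (subst tensor_lift_pure[OF kspace_F kspace_k2 kspace_mat_polys kbilinear_to_poly]) simp_all
  also have "\<dots> = Polynomial.monom (outer v u) n"
    by (rule poly_eqI) (simp add: F_to_poly_pure coeff_map_poly)
  finally show ?thesis .
qed

text \<open>
  The element of \<open>F \<otimes> k\<^sup>2\<close> that corresponds to \<open>A t\<^sup>n\<close>: the first factors are the standard basis of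
  \<open>k\<^sup>2\<close>, and the second factors are the rows of \<open>A\<close>.
\<close>

definition homog :: "nat \<Rightarrow> 'k::field^2^2 \<Rightarrow> 'k FKvec"
  where "homog n A = pureFK (pureF (axis 1 1) (Polynomial.monom 1 n)) (A $ 1)
    \<oplus>\<^bsub>FK\<^esub> pureFK (pureF (axis 2 1) (Polynomial.monom 1 n)) (A $ 2)"

lemma klinear_homog: "klinear M2 FK (homog n)"
proof -
  interpret FK: kspace FK by (rule kspace_FK)
  have row: "mscale d A $ r = d *s A $ r" for d and A :: "'a^2^2" and r
    by (simp add: vec_eq_iff)
  show ?thesis
    by (rule klinearI) (auto simp: homog_def row FK.smult_add FK.a_ac)
qed

lemmas homog_rules = klinearD[OF klinear_homog, simplified]

lemma homog_outer: "homog n (outer v u) = pureFK (pureF v (Polynomial.monom 1 n)) u"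
proof -
  interpret F: kspace F by (rule kspace_F)
  let ?t = "Polynomial.monom 1 n"
  have row: "outer v u $ r = v $ r *s u" for r
    by (simp add: vec_eq_iff outer_def)
  have v: "v = v $ 1 *s axis 1 1 + v $ 2 *s axis 2 1"
    by (simp add: vec_eq_iff forall_2 axis_def)
  have "homog n (outer v u) =
      pureFK (pureF (v $ 1 *s axis 1 1) ?t) u \<oplus>\<^bsub>FK\<^esub> pureFK (pureF (v $ 2 *s axis 2 1) ?t) u"
    by (simp add: homog_def row)
  also have "\<dots> = pureFK (pureF (v $ 1 *s axis 1 1 + v $ 2 *s axis 2 1) ?t) u"
    by simp
  finally show ?thesis
    using v by simp
qed

lemma to_poly_homog: "to_poly (homog n A) = Polynomial.monom A n"
  by (simp add: homog_def klinearD[OF klinear_to_poly] to_poly_pure add_monom outer_rows)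

lemma homog_inject [simp]: "homog n A = homog n B \<longleftrightarrow> A = B"
  using to_poly_homog[of n A] to_poly_homog[of n B] by (metis monom_eq_iff)

lemma klinear_FK_eqI_homog:
  assumes "klinear FK U f" and "klinear FK U g" and "\<And>n A. f (homog n A) = g (homog n A)"
    and "X \<in> carrier FK"
  shows "f X = g X"
  by (rule klinear_FK_eqI_monom[OF assms(1,2) _ assms(4)]) (metis assms(3) homog_outer)

definition from_poly :: "('k::field^2^2) poly \<Rightarrow> 'k FKvec"
  where "from_poly p = (\<Oplus>\<^bsub>FK\<^esub>n\<in>{..degree p}. homog n (coeff p n))"

lemma homog_zero [simp]: "homog n 0 = \<zero>\<^bsub>FK\<^esub>"
  using klinear_zero[OF klinear_homog kspace_M2 kspace_FK] by simp

lemma from_poly_le: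
  assumes "degree p \<le> N"
  shows "from_poly p = (\<Oplus>\<^bsub>FK\<^esub>n\<in>{..N}. homog n (coeff p n))"
proof -
  interpret FK: kspace FK by (rule kspace_FK)
  show ?thesis
    unfolding from_poly_def
    by (rule FK.add.finprod_mono_neutral_cong_left)
      (use assms in \<open>auto simp: homog_rules coeff_eq_0\<close>)
qed

lemma klinear_from_poly: "klinear mat_polys FK from_poly"
proof (rule klinearI)
  interpret FK: kspace FK by (rule kspace_FK)
  fix p :: "('a^2^2) poly"
  show "from_poly p \<in> carrier FK"
    unfolding from_poly_def by (rule FK.finsum_closed) (simp add: homog_rules)
  show "from_poly (c \<odot>\<^bsub>mat_polys\<^esub> p) = c \<odot>\<^bsub>FK\<^esub> from_poly p" for c
  proof -
    have deg: "degree (map_poly (mscale c) p) \<le> degree p"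
      by (rule degree_le) (simp add: coeff_map_poly coeff_eq_0)
    have "from_poly (map_poly (mscale c) p) = (\<Oplus>\<^bsub>FK\<^esub>n\<in>{..degree p}. c \<odot>\<^bsub>FK\<^esub> homog n (coeff p n))"
      unfolding from_poly_le[OF deg] by (simp add: coeff_map_poly homog_rules)
    also have "\<dots> = c \<odot>\<^bsub>FK\<^esub> from_poly p"
      unfolding from_poly_def by (rule FK.finsum_smult) (simp add: homog_rules)
    finally show ?thesis
      by simp
  qed
  fix p' :: "('a^2^2) poly"
  define N where "N = max (degree p) (degree p')"
  have N: "degree p \<le> N" "degree p' \<le> N" "degree (p + p') \<le> N"
    unfolding N_def by (auto intro: degree_add_le)
  show "from_poly (p \<oplus>\<^bsub>mat_polys\<^esub> p') = from_poly p \<oplus>\<^bsub>FK\<^esub> from_poly p'"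
    unfolding mat_polys_simps from_poly_le[OF N(1)] from_poly_le[OF N(2)] from_poly_le[OF N(3)]
    by (subst FK.finsum_addf[symmetric]) (simp_all add: homog_rules)
qed

lemma from_poly_monom: "from_poly (Polynomial.monom A n) = homog n A"
proof -
  interpret FK: kspace FK by (rule kspace_FK)
  have "from_poly (Polynomial.monom A n) = (\<Oplus>\<^bsub>FK\<^esub>m\<in>{..n}. homog m (if n = m then A else 0))"
    by (simp add: from_poly_le[OF degree_monom_le])
  also have "\<dots> = (\<Oplus>\<^bsub>FK\<^esub>m\<in>{..n}. if n = m then homog m A else \<zero>\<^bsub>FK\<^esub>)"
    by (rule FK.finsum_cong'[OF refl]) (auto simp: homog_rules)
  also have "\<dots> = homog n A"
    by (rule FK.finsum_singleton) (auto simp: homog_rules)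
  finally show ?thesis .
qed

text \<open>
  The right-hand side is closed under linear combinations and contains the generators of the left-hand side.
\<close>

lemma FK_degree_eq: "FK_degree n = range (homog n)"
proof (intro equalityI subsetI)
  fix X :: "'a FKvec" assume "X \<in> FK_degree n"
  then obtain p where X: "X = tensor_class F k2 p" and p: "Poly_Mapping.keys p \<subseteq> F_degree n \<times> UNIV"
    by (auto simp: FK_degree_def)
  have "tensor_class F k2 p \<in> range (homog n)"
    using p
  proof (induction p rule: finsupp_induct)
    case zero
    have "tensor_class F k2 0 = homog n 0"
      by (simp add: FK_def tensor_space_zero)
    then show ?case by blast
  next
    case (single z d)
    then obtain v u where z: "z = (pureF v (Polynomial.monom 1 n), u)"
      by (auto simp: F_degree_def)
    have "tensor_class F k2 (Poly_Mapping.single z d) = d \<odot>\<^bsub>FK\<^esub> pureFK (pureF v (Polynomial.monom 1 n)) u"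
      by (simp add: z FK_def pure_tensor_def)
    also have "\<dots> = homog n (mscale d (outer v u))"
      by (simp add: homog_rules homog_outer)
    finally show ?case by blast
  next
    case (add p q)
    then obtain A B where "tensor_class F k2 p = homog n A" "tensor_class F k2 q = homog n B"
      by blast
    moreover have "tensor_class F k2 p \<oplus>\<^bsub>FK\<^esub> tensor_class F k2 q = tensor_class F k2 (p + q)"
      by (simp add: FK_def)
    ultimately have "tensor_class F k2 (p + q) = homog n (A + B)"
      by (simp add: homog_rules)
    then show ?case by blast
  qed
  then show "X \<in> range (homog n)"
    by (simp add: X)
next
  fix X :: "'a FKvec" assume "X \<in> range (homog n)"
  then obtain A where X: "X = homog n A"
    by blast
  let ?x = "\<lambda>r. (pureF (axis r 1) (Polynomial.monom 1 n), A $ r)"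
  have "X = tensor_class F k2 (gen (?x 1) + gen (?x 2))"
    by (simp add: X homog_def FK_def pure_tensor_def)
  moreover have "Poly_Mapping.keys (gen (?x 1) + gen (?x 2) :: _ \<Rightarrow>\<^sub>0 'a) \<subseteq> F_degree n \<times> UNIV"
    by (rule subset_trans[OF keys_add]) (auto simp: F_degree_def)
  ultimately show "X \<in> FK_degree n"
    by (auto simp: FK_degree_def)
qed

definition word_mat :: "(idx \<Rightarrow> 'k::field^2^2) \<Rightarrow> monomial \<Rightarrow> 'k^2^2"
  where "word_mat \<rho> w = foldr (\<lambda>l. (**) (\<rho> l)) (letters w) (mat 1)"

lemma monomial_act_word_mat: "monomial_act \<rho> w v = word_mat \<rho> w *v v"
proof -
  have "foldr (\<lambda>l. (*v) (\<rho> l)) ls v = foldr (\<lambda>l. (**) (\<rho> l)) ls (mat 1) *v v" for ls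
    by (induction ls) (simp_all add: matrix_vector_mul_assoc)
  then show ?thesis
    by (simp add: monomial_act_def word_mat_def)
qed

lemma (in S_rep) FK_act_word:
  "FK_act \<alpha> \<rho> (pure_tensor (S \<alpha>) M2 (S_class \<alpha> (gen w)) m) (homog n A) =
    homog (length (letters w) + n) (word_mat \<rho> w ** A ** transpose m)"
proof -
  let ?y = "pure_tensor (S \<alpha>) M2 (S_class \<alpha> (gen w)) m" and ?N = "length (letters w) + n"
  have y: "?y \<in> carrier (tensor_space (S \<alpha>) M2)"
    by (rule kbilinearD(1)[OF kbilinear_pure_tensor]) simp_all
  note lin = klinearD[OF klinear_FK_act_right[OF y]]
  have pure: "FK_act \<alpha> \<rho> ?y (pureFK (pureF v (Polynomial.monom 1 n)) u) =
      homog ?N (outer (word_mat \<rho> w *v v) (m *v u))" for v u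
    by (simp add: FK_act_pure FK_pure_act_pure F_act_word homog_outer monomial_act_word_mat
        mult_monom del: F_act_pure)
  have "FK_act \<alpha> \<rho> ?y (homog n A) = homog ?N (outer (word_mat \<rho> w *v axis 1 1) (m *v A $ 1)
      + outer (word_mat \<rho> w *v axis 2 1) (m *v A $ 2))"
    by (simp add: homog_def[of n] lin pure homog_rules)
  also have "outer (W *v axis 1 1) (m *v A $ 1) + outer (W *v axis 2 1) (m *v A $ 2) =
      W ** A ** transpose m" for W
    by (simp add: outer_def vec_eq_iff forall_2 axis_def matrix_matrix_mult_def matrix_vector_mult_def
        sum_2 transpose_def algebra_simps)
  finally show ?thesis .
qed

definition poly_coeffwise :: "(nat \<Rightarrow> 'k::field^2^2 \<Rightarrow> 'k^2^2) \<Rightarrow> ('k^2^2) poly \<Rightarrow> ('k^2^2) poly"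
  where "poly_coeffwise T p = (\<Sum>n\<le>degree p. Polynomial.monom (T n (coeff p n)) n)"

text \<open>
  The map \<open>A t\<^sup>n \<mapsto> T\<^sub>n(A) t\<^sup>n\<close>.
\<close>

definition FK_coeffwise :: "(nat \<Rightarrow> 'k::field^2^2 \<Rightarrow> 'k^2^2) \<Rightarrow> 'k FKvec \<Rightarrow> 'k FKvec"
  where "FK_coeffwise T X = from_poly (poly_coeffwise T (to_poly X))"

lemma
  assumes T: "\<And>n. klinear M2 M2 (T n)"
  shows klinear_FK_coeffwise: "klinear FK FK (FK_coeffwise T)"
    and FK_coeffwise_homog: "FK_coeffwise T (homog n A) = homog n (T n A)"
proof -
  have T0 [simp]: "T n 0 = 0" for n
    using klinear_zero[OF T kspace_M2 kspace_M2] by simp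
  have coeff: "coeff (poly_coeffwise T p) n = T n (coeff p n)" for p n
  proof -
    have "coeff (poly_coeffwise T p) n = (\<Sum>m\<le>degree p. if m = n then T n (coeff p n) else 0)"
      by (auto simp: poly_coeffwise_def coeff_sum intro!: sum.cong)
    then show ?thesis
      by (simp add: coeff_eq_0)
  qed
  have "klinear mat_polys mat_polys (poly_coeffwise T)"
    by (rule klinearI) (auto intro!: poly_eqI simp: coeff coeff_map_poly klinearD[OF T, simplified])
  then show "klinear FK FK (FK_coeffwise T)"
    unfolding FK_coeffwise_def[abs_def]
    using klinear_compose[OF klinear_to_poly klinear_compose[OF _ klinear_from_poly]] by blast
  have "poly_coeffwise T (Polynomial.monom A n) = Polynomial.monom (T n A) n"
    by (rule poly_eqI) (simp add: coeff)
  then show "FK_coeffwise T (homog n A) = homog n (T n A)"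
    by (simp add: FK_coeffwise_def to_poly_homog from_poly_monom)
qed

section \<open>Quaternion matrices and the modules V\<close>

lemma klein_mult_left [simp]: "klein_mult j (klein_mult j l) = l"
  by (cases j; cases l) simp_all

text \<open>
  Together with \<open>gen_sign_commute\<close>: the signs by which \<open>\<Gamma>\<close> acts on the generators form a symmetric
  bicharacter of \<open>\<Gamma>\<close>.
\<close>

lemma gen_sign_mult: "gen_sign g (klein_mult h l) = (gen_sign g h * gen_sign g l :: 'k::field)"
  by (cases g; cases h; cases l) (simp_all add: gen_sign_def)

lemma gen_sign_commute: "gen_sign g h = (gen_sign h g :: 'k::field)"
  by (auto simp: gen_sign_def)

lemma gen_sign_I0 [simp]: "gen_sign g I0 = 1" "gen_sign I0 g = 1"
  by (simp_all add: gen_sign_def)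

lemma gen_sign_square [simp]: "gen_sign g h * gen_sign g h = (1 :: 'k::field)"
  "gen_sign g h * (gen_sign g h * x) = (x :: 'k::field)"
  by (simp_all add: gen_sign_def)

lemmas mat2_eq_iff = vec_eq_iff forall_2 matrix_matrix_mult_def sum_2 mat_def

context
  fixes i :: "'k::field"
  assumes ii: "i * i = - 1"
begin

lemma q_commute: "q i g ** q i h = mscale (gen_sign g h) (q i h ** q i g)"
  by (cases g; cases h) (simp_all add: mat2_eq_iff gen_sign_def ii)

lemma q_square: "\<exists>e. e \<noteq> 0 \<and> q i g ** q i g = mscale e (mat 1)"
  by (cases g) (auto simp: mat2_eq_iff ii intro: exI[of _ 1] exI[of _ "- 1"])

lemma q_inverse [simp]: "q i g ** matrix_inv (q i g) = mat 1" "matrix_inv (q i g) ** q i g = mat 1"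
proof -
  obtain e where e: "e \<noteq> 0" "q i g ** q i g = mscale e (mat 1)"
    using q_square by blast
  then have "q i g ** mscale (1 / e) (q i g) = mat 1" "mscale (1 / e) (q i g) ** q i g = mat 1"
    by (simp_all add: mscale_mult)
  then have "q i g ** matrix_inv (q i g) = mat 1 \<and> matrix_inv (q i g) ** q i g = mat 1"
    using someI[of "\<lambda>A. q i g ** A = mat 1 \<and> A ** q i g = mat 1" "mscale (1 / e) (q i g)"]
    by (simp add: matrix_inv_def)
  then show "q i g ** matrix_inv (q i g) = mat 1" "matrix_inv (q i g) ** q i g = mat 1"
    by blast+
qed

lemma q_inverse_assoc [simp]:
  "q i g ** (matrix_inv (q i g) ** A) = A" "matrix_inv (q i g) ** (q i g ** A) = A"
  by (simp_all add: matrix_mul_assoc)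

lemma transpose_q_inverse [simp]:
  "transpose (q i g) ** transpose (matrix_inv (q i g)) = mat 1"
  "transpose (matrix_inv (q i g)) ** transpose (q i g) = mat 1"
  by (simp_all flip: matrix_transpose_mul add: transpose_mat)

lemma transpose_q_inverse_assoc [simp]:
  "transpose (q i g) ** (transpose (matrix_inv (q i g)) ** A) = A"
  "transpose (matrix_inv (q i g)) ** (transpose (q i g) ** A) = A"
  by (simp_all add: matrix_mul_assoc)

lemma q_mult: "\<exists>e. e * e = 1 \<and> q i g ** q i h = mscale e (q i (klein_mult g h))"
  by (cases g; cases h)
    (simp_all add: mat2_eq_iff ii, (rule exI[of _ 1], simp add: ii; fail | rule exI[of _ "- 1"], simp add: ii; fail)+)

text \<open>
  Commuting with the diagonal matrix \<open>q\<^sub>1\<close>, whose eigenvalues are different, forces \<open>N\<close> to be diagonal.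
  Commuting with \<open>q\<^sub>2\<close>, which interchanges the two coordinate lines, makes the two entries equal.
\<close>

lemma commutes_q_imp_scalar:
  assumes two: "(2::'k) \<noteq> 0" and N: "\<And>h. N ** q i h = q i h ** N"
  shows "N = mscale (N $ 1 $ 1) (mat 1)"
proof -
  have i0: "i \<noteq> 0"
    using ii by auto
  have "2 * (i * N $ 1 $ 2) = 0" "2 * (i * N $ 2 $ 1) = 0"
    using N[of I1] by (simp_all add: mat2_eq_iff algebra_simps)
  moreover have "i * N $ 1 $ 1 = i * N $ 2 $ 2"
    using N[of I2] by (simp add: mat2_eq_iff algebra_simps)
  ultimately show ?thesis
    using two i0 by (simp add: mat2_eq_iff)
qed

end

text \<open>
  Up to nonzero scalars, \<open>V(\<tau> + \<xi>\<^sub>j)\<close> arises from \<open>V(\<tau>)\<close> by translating the indices by \<open>j\<close> in \<open>\<Gamma>\<close>.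
\<close>

lemma V_gen_eq_q:
  assumes "a \<noteq> 0" "b \<noteq> 0" "c \<noteq> 0" "i \<noteq> 0"
  shows "\<exists>d. V_gen a b c i j l = mscale d (q i (klein_mult j l)) \<and> d \<noteq> (0::'k::field)"
proof -
  have mat: "mat d = mscale d (mat 1 :: 'k^2^2)" for d
    by (simp add: mat2_eq_iff)
  have one: "\<exists>d. A = mscale d A \<and> d \<noteq> 0" for A :: "'k^2^2"
    by (rule exI[of _ 1]) simp
  show ?thesis
    by (cases j; cases l) (simp_all only: V_gen.simps klein_mult.simps q.simps(1) mat[of "- i"],
      (rule one | (rule exI, rule conjI[OF refl], simp add: assms))+)
qed

lemma S_rep_V_gen:
  assumes ii: "i * i = - 1" and \<alpha>: "\<alpha> I1 = a * a" "\<alpha> I2 = b * b" "\<alpha> I3 = c * (c::'k::field)"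
  shows "S_rep \<alpha> (V_gen a b c i j)"
proof
  fix r and v :: "'k^2"
  assume "r \<in> S_relations \<alpha>"
  have ii': "i * (i * x) = - x" for x
    using ii by (simp flip: mult.assoc)
  let ?\<rho> = "V_gen a b c i j"
  have act: "free_act ?\<rho> (xgen k * xgen l) v = ?\<rho> k *v (?\<rho> l *v v)" for k l
    by (simp add: xgen_def mult_single monomial_act_def plus_monomial_def)
  have "?\<rho> I0 *v (?\<rho> k *v v) - ?\<rho> k *v (?\<rho> I0 *v v) = \<alpha> k *s (?\<rho> l *v (?\<rho> m *v v) + ?\<rho> m *v (?\<rho> l *v v))"
    "?\<rho> I0 *v (?\<rho> k *v v) + ?\<rho> k *v (?\<rho> I0 *v v) = ?\<rho> l *v (?\<rho> m *v v) - ?\<rho> m *v (?\<rho> l *v v)"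
    if "(k, l, m) \<in> cyclic" for k l m
    using that
    by (cases j; auto simp: cyclic_def vec_eq_iff forall_2 matrix_vector_mult_def sum_2 mat_def \<alpha> ii ii' algebra_simps)+
  then show "free_act ?\<rho> r v = 0"
    using \<open>r \<in> S_relations \<alpha>\<close> by (auto simp: S_relations_def act vector_add_ldistrib)
qed

lemma word_mat_zero [simp]: "word_mat \<rho> 0 = mat 1"
  by (simp add: word_mat_def zero_monomial_def)

lemma word_mat_letter [simp]: "word_mat \<rho> (Mon [l]) = \<rho> l"
  by (simp add: word_mat_def)

section \<open>Schur's lemma, twisted by an element of the group\<close>

text \<open>
  The shape, in degree \<open>n\<close>, of all maps that are compatible with \<open>S'\<close> up to the action of \<open>g\<close>.
\<close>

definition twist :: "'k::field \<Rightarrow> idx \<Rightarrow> 'k \<Rightarrow> idx \<Rightarrow> nat \<Rightarrow> 'k^2^2 \<Rightarrow> 'k^2^2"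
  where "twist i j \<kappa> g n A = mscale (\<kappa> * gen_sign g j ^ n) (q i g ** A ** transpose (q i g))"

lemma klinear_twist: "klinear M2 M2 (twist i j \<kappa> g n)"
  by (rule klinearI) (simp_all add: twist_def mat2_distrib mscale_mult mscale_add(1) mult_ac)

text \<open>
  The transposes enter because \<open>1 \<otimes> m\<close> acts on \<open>v u\<^sup>T\<close> by \<open>v (m u)\<^sup>T = v u\<^sup>T m\<^sup>T\<close>. Linearity of the \<open>T n\<close> comes
  out of the compatibility with \<open>1 \<otimes> M\<^sub>2(k)\<close>, which contains the scalars.
\<close>

lemma twisted_schur:
  fixes a b c i :: "'k::field"
  assumes nz: "a \<noteq> 0" "b \<noteq> 0" "c \<noteq> 0" and two: "(2::'k) \<noteq> 0" and ii: "i * i = - 1"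
    and right: "\<And>n A m. T n (A ** transpose m) = T n A ** transpose (M2_\<Gamma> i g m)"
    and left: "\<And>n l A. T (Suc n) (V_gen a b c i j l ** A) = mscale (gen_sign g l) (V_gen a b c i j l ** T n A)"
  shows "\<exists>\<kappa>. \<forall>n. T n = twist i j \<kappa> g n"
proof -
  let ?Q = "q i g" and ?R = "matrix_inv (q i g)"
  note inv [simp] = q_inverse[OF ii] q_inverse_assoc[OF ii] transpose_q_inverse[OF ii]
    transpose_q_inverse_assoc[OF ii]
  have scalar: "T n (mscale d A) = mscale d (T n A)" for n d A
    using right[of n A "mscale d (mat 1)"]
    by (simp add: M2_\<Gamma>_def transpose_mscale mscale_mult transpose_mat)
  have left_q: "T (Suc n) (q i h ** A) = mscale (gen_sign g j * gen_sign g h) (q i h ** T n A)" for n h A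
  proof -
    have "i \<noteq> 0"
      using ii by auto
    then obtain d where d: "V_gen a b c i j (klein_mult j h) = mscale d (q i h)" "d \<noteq> 0"
      using V_gen_eq_q[OF nz, of i j "klein_mult j h"] by auto
    from left[of n "klein_mult j h" A]
    have "mscale d (T (Suc n) (q i h ** A)) = mscale d (mscale (gen_sign g j * gen_sign g h) (q i h ** T n A))"
      by (simp add: d(1) mscale_mult scalar gen_sign_mult mult_ac)
    then have "mscale (1 / d) (mscale d (T (Suc n) (q i h ** A))) =
        mscale (1 / d) (mscale d (mscale (gen_sign g j * gen_sign g h) (q i h ** T n A)))"
      by simp
    then show ?thesis
      using d(2) by simp
  qed
  have T: "T n A = mscale (gen_sign g j ^ n) (T 0 A)" for n A
  proof (induction n)
    case (Suc n)
    then show ?case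
      using left_q[of n I0 A] by simp
  qed simp
  have T0_q: "T 0 (q i h ** A) = mscale (gen_sign g h) (q i h ** T 0 A)" for h A
  proof -
    have "mscale (gen_sign g j) (T 0 (q i h ** A)) = mscale (gen_sign g j) (mscale (gen_sign g h) (q i h ** T 0 A))"
      using left_q[of 0 h A] T[of 1 "q i h ** A"] by simp
    then have "mscale (gen_sign g j) (mscale (gen_sign g j) (T 0 (q i h ** A))) =
        mscale (gen_sign g j) (mscale (gen_sign g j) (mscale (gen_sign g h) (q i h ** T 0 A)))"
      by simp
    then show ?thesis
      by simp
  qed
  have T0: "T 0 A = T 0 (mat 1) ** (transpose ?R ** A ** transpose ?Q)" for A
    using right[of 0 "mat 1" "transpose A"]
    by (simp add: M2_\<Gamma>_def matrix_transpose_mul matrix_mul_assoc)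
  \<comment> \<open>The scalar in question: \<open>T 0 A = q\<^sub>g N A q\<^sub>g\<^sup>T\<close>.\<close>
  define N where "N = ?R ** T 0 (mat 1) ** transpose ?R"
  have T01: "T 0 (mat 1) = ?Q ** N ** transpose ?Q"
    by (simp add: N_def flip: matrix_mul_assoc)
  have "N ** q i h = q i h ** N" for h
  proof -
    have "?Q ** (N ** q i h) ** transpose ?Q = T 0 (q i h)"
      using T0[of "q i h"] by (simp add: T01 flip: matrix_mul_assoc)
    also have "\<dots> = mscale (gen_sign g h) (q i h ** ?Q) ** N ** transpose ?Q"
      using T0_q[of h "mat 1"] by (simp add: T01 mscale_mult flip: matrix_mul_assoc)
    also have "mscale (gen_sign g h) (q i h ** ?Q) = ?Q ** q i h"
      by (rule q_commute[OF ii, symmetric])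
    finally have "?R ** (?Q ** (N ** q i h) ** transpose ?Q) ** transpose ?R =
        ?R ** (?Q ** q i h ** N ** transpose ?Q) ** transpose ?R"
      by simp
    then show ?thesis
      by (simp flip: matrix_mul_assoc)
  qed
  then obtain \<kappa> where "N = mscale \<kappa> (mat 1)"
    using commutes_q_imp_scalar[OF ii two] by blast
  then have "T 0 A = mscale \<kappa> (?Q ** A ** transpose ?Q)" for A
    using T0[of A] by (simp add: T01 mscale_mult flip: matrix_mul_assoc)
  then have "T n A = twist i j \<kappa> g n A" for n A
    using T[of n A] by (simp add: twist_def mult.commute)
  then show ?thesis
    by blast
qed

lemma twist_inject:
  assumes ii: "i * i = - 1" and "twist i j \<kappa> g 0 (mat 1) = twist i j \<mu> g 0 (mat 1)"
  shows "\<kappa> = (\<mu> :: 'k::field)"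
proof -
  let ?R = "matrix_inv (q i g)"
  note inv [simp] = q_inverse[OF ii] q_inverse_assoc[OF ii] transpose_q_inverse[OF ii]
    transpose_q_inverse_assoc[OF ii]
  have "?R ** twist i j \<nu> g 0 (mat 1) ** transpose ?R = mscale \<nu> (mat 1)" for \<nu>
    by (simp add: twist_def mscale_mult flip: matrix_mul_assoc)
  then have "mscale \<kappa> (mat 1 :: 'k^2^2) = mscale \<mu> (mat 1)"
    using assms(2) by metis
  then show ?thesis
    by (simp add: mat2_eq_iff)
qed

text \<open>
  The sign by which \<open>q\<^sub>g q\<^sub>h\<close> and \<open>q\<^bsub>g\<cdot>h\<^esub>\<close> differ occurs both on the left and on the right of \<open>A\<close>.
\<close>

lemma twist_twist:
  assumes ii: "i * i = - (1 :: 'k::field)"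
  shows "twist i j \<kappa> g n (twist i j \<mu> h n A) = twist i j (\<kappa> * \<mu>) (klein_mult g h) n A"
proof -
  obtain e where e: "e * e = 1" "q i g ** q i h = mscale e (q i (klein_mult g h))"
    using q_mult[OF ii] by blast
  have "q i g ** (q i h ** A ** transpose (q i h)) ** transpose (q i g) =
      (q i g ** q i h) ** A ** transpose (q i g ** q i h)"
    by (simp add: matrix_transpose_mul matrix_mul_assoc)
  also have "\<dots> = q i (klein_mult g h) ** A ** transpose (q i (klein_mult g h))"
    by (simp add: e transpose_mscale mscale_mult)
  finally have *: "q i g ** (q i h ** A ** transpose (q i h)) ** transpose (q i g) =
      q i (klein_mult g h) ** A ** transpose (q i (klein_mult g h))" .
  have "gen_sign (klein_mult g h) j = (gen_sign g j * gen_sign h j :: 'k)"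
    by (metis gen_sign_commute gen_sign_mult)
  then show ?thesis
    by (simp add: twist_def mscale_mult * power_mult_distrib mult_ac)
qed

lemma twist_I0 [simp]: "twist i j 1 I0 n A = A"
  by (simp add: twist_def transpose_mat)

text \<open>
  Moving \<open>q\<^sub>g\<close> past the letter \<open>x\<^sub>l\<close>, a multiple of \<open>q\<^bsub>j\<cdot>l\<^esub>\<close>, costs the sign \<open>\<langle>g, j\<rangle> \<langle>g, l\<rangle>\<close>. The factors
  \<open>\<langle>g, j\<rangle>\<close> cancel against the change of degree, and the factors \<open>\<langle>g, l\<rangle>\<close> are the action of \<open>g\<close> on the word.
\<close>

lemma twist_equivariant:
  assumes nz: "a \<noteq> 0" "b \<noteq> 0" "c \<noteq> 0" and ii: "i * i = - (1 :: 'k::field)"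
  shows "twist i j \<kappa> g (length (letters w) + n) (word_mat (V_gen a b c i j) w ** A ** transpose m) =
    mscale (word_sign g w) (word_mat (V_gen a b c i j) w ** twist i j \<kappa> g n A ** transpose (M2_\<Gamma> i g m))"
proof -
  let ?\<rho> = "V_gen a b c i j"
  note inv [simp] = q_inverse[OF ii] q_inverse_assoc[OF ii] transpose_q_inverse[OF ii]
    transpose_q_inverse_assoc[OF ii]
  have "i \<noteq> 0"
    using ii by auto
  have letter: "q i g ** ?\<rho> l = mscale (gen_sign g j * gen_sign g l) (?\<rho> l ** q i g)" for l
  proof -
    obtain d where d: "?\<rho> l = mscale d (q i (klein_mult j l))"
      using V_gen_eq_q[OF nz \<open>i \<noteq> 0\<close>] by blast
    show ?thesis
      using q_commute[OF ii, of g "klein_mult j l"]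
      by (simp add: d mscale_mult gen_sign_mult mult_ac)
  qed
  have "q i g ** foldr (\<lambda>l. (**) (?\<rho> l)) ls (mat 1) =
      mscale (gen_sign g j ^ length ls * prod_list (map (gen_sign g) ls))
        (foldr (\<lambda>l. (**) (?\<rho> l)) ls (mat 1) ** q i g)" for ls
  proof (induction ls)
    case (Cons l ls)
    then show ?case
      by (simp add: letter mscale_mult mult_ac matrix_mul_assoc) (simp add: mscale_mult mult_ac flip: matrix_mul_assoc)
  qed simp
  then have word: "q i g ** word_mat ?\<rho> w =
      mscale (gen_sign g j ^ length (letters w) * word_sign g w) (word_mat ?\<rho> w ** q i g)"
    by (simp add: word_mat_def word_sign_def)
  have sq: "gen_sign g j ^ k * gen_sign g j ^ k = (1::'k)" for k
    by (simp flip: power_mult_distrib)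
  have "q i g ** (word_mat ?\<rho> w ** A ** transpose m) ** transpose (q i g) =
      mscale (gen_sign g j ^ length (letters w) * word_sign g w)
        (word_mat ?\<rho> w ** (q i g ** A ** transpose (q i g)) ** transpose (M2_\<Gamma> i g m))"
    by (simp add: M2_\<Gamma>_def matrix_transpose_mul matrix_mul_assoc word mscale_mult)
       (simp flip: matrix_mul_assoc)
  then show ?thesis
    using sq[of "length (letters w)"]
    by (simp add: twist_def mscale_mult power_add mult_ac)
qed

section \<open>Equivariant structures\<close>

lemma group_\<Gamma>: "group \<Gamma>"
proof (rule groupI)
  fix x y z assume "x \<in> carrier \<Gamma>"
  show "x \<otimes>\<^bsub>\<Gamma>\<^esub> y \<otimes>\<^bsub>\<Gamma>\<^esub> z = x \<otimes>\<^bsub>\<Gamma>\<^esub> (y \<otimes>\<^bsub>\<Gamma>\<^esub> z)"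
    by (cases x; cases y; cases z) (simp_all add: \<Gamma>_def)
  show "\<exists>y\<in>carrier \<Gamma>. y \<otimes>\<^bsub>\<Gamma>\<^esub> x = \<one>\<^bsub>\<Gamma>\<^esub>"
    by (rule bexI[of _ x]; cases x) (simp_all add: \<Gamma>_def)
qed (simp_all add: \<Gamma>_def)

lemma \<Gamma>_simps [simp]: "carrier \<Gamma> = UNIV" "g \<otimes>\<^bsub>\<Gamma>\<^esub> h = klein_mult g h" "\<one>\<^bsub>\<Gamma>\<^esub> = I0"
  by (simp_all add: \<Gamma>_def)

text \<open>
  A character of \<open>\<Gamma>\<close> has values \<open>\<plusminus>1\<close> and is determined by its values at two generators.
\<close>

lemma character_eq_gen_sign:
  assumes mult: "\<And>g h. \<theta> (klein_mult g h) = \<theta> g * \<theta> h" and one: "\<theta> I0 = (1 :: 'k::field)"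
  shows "\<exists>h. \<forall>g. \<theta> g = gen_sign h g"
proof -
  have sq: "\<theta> g = 1 \<or> \<theta> g = - 1" for g
  proof -
    have "\<theta> g * \<theta> g = 1"
      using mult[of g g] one by (cases g) simp_all
    then show ?thesis
      by (simp add: square_eq_1_iff)
  qed
  have I3: "\<theta> I3 = \<theta> I1 * \<theta> I2"
    using mult[of I1 I2] by simp
  \<comment> \<open>\<open>h\<close> is read off from the signs at \<open>g\<^sub>1\<close> and \<open>g\<^sub>2\<close>: \<open>g\<^sub>j\<close> preserves only \<open>x\<^sub>0\<close> and \<open>x\<^sub>j\<close>.\<close>
  define h where "h = (if \<theta> I1 = 1 then if \<theta> I2 = 1 then I0 else I1 else if \<theta> I2 = 1 then I2 else I3)"
  have "\<theta> g = gen_sign h g" for g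
    using sq[of I1] sq[of I2] I3 one by (cases g) (auto simp: h_def gen_sign_def)
  then show ?thesis
    by blast
qed

lemma gen_sign_inject:
  assumes "(2 :: 'k::field) \<noteq> 0" and "\<And>g. gen_sign h g = (gen_sign h' g :: 'k)"
  shows "h = h'"
proof -
  have "(1 :: 'k) \<noteq> - 1"
  proof
    assume "(1 :: 'k) = - 1"
    then have "(1 :: 'k) + 1 = 0"
      by (metis add.right_inverse)
    then show False
      using assms(1) by simp
  qed
  then show ?thesis
    using assms(2)[of I1] assms(2)[of I2] assms(2)[of I3]
    by (cases h; cases h') (auto simp: gen_sign_def)
qed

text \<open>
  The consequences of the hypotheses on which the count depends: \<open>2 \<noteq> 0\<close> distinguishes the signs, and
  \<open>a\<close>, \<open>b\<close>, \<open>c\<close> being nonzero makes every generator act invertibly.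
\<close>

locale equivariant_setting =
  fixes \<alpha> :: "idx \<Rightarrow> 'k::field" and a b c i :: 'k and j :: idx
  assumes nz: "a \<noteq> 0" "b \<noteq> 0" "c \<noteq> 0" and two: "(2 :: 'k) \<noteq> 0" and ii: "i * i = - 1"
    and \<alpha>: "\<alpha> I1 = a * a" "\<alpha> I2 = b * b" "\<alpha> I3 = c * c"
begin

abbreviation \<rho> :: "idx \<Rightarrow> 'k^2^2"
  where "\<rho> \<equiv> V_gen a b c i j"

abbreviation act :: "('k free_alg set \<times> ('k^2^2) \<Rightarrow>\<^sub>0 'k) set \<Rightarrow> 'k FKvec \<Rightarrow> 'k FKvec"
  where "act \<equiv> FK_act \<alpha> \<rho>"

abbreviation SM :: "('k, ('k free_alg set \<times> ('k^2^2) \<Rightarrow>\<^sub>0 'k) set) module"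
  where "SM \<equiv> tensor_space (S \<alpha>) M2"

sublocale S_rep \<alpha> \<rho>
  by (rule S_rep_V_gen[of i \<alpha>, OF ii \<alpha>])

sublocale FK: kspace FK
  by (rule kspace_FK)

abbreviation word_tensor :: "monomial \<Rightarrow> 'k^2^2 \<Rightarrow> ('k free_alg set \<times> ('k^2^2) \<Rightarrow>\<^sub>0 'k) set"
  where "word_tensor w m \<equiv> pure_tensor (S \<alpha>) M2 (S_class \<alpha> (gen w)) m"

lemma word_tensor_carrier [simp, intro]: "word_tensor w m \<in> carrier SM"
  by (rule kbilinearD(1)[OF kbilinear_pure_tensor]) simp_all

lemma act_\<Gamma>_word:
  "act (S'_\<Gamma> \<alpha> i g (word_tensor w m)) (homog n A) =
    homog (length (letters w) + n) (mscale (word_sign g w) (word_mat \<rho> w ** A ** transpose (M2_\<Gamma> i g m)))"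
  unfolding S'_\<Gamma>_word
  by (simp add: klinearD[OF klinear_FK_act_left] homog_rules FK_act_word)

text \<open>
  By the gradings \<open>f\<close> is given in degree \<open>n\<close> by a map \<open>T n\<close> of matrices, to which the twisted form of
  Schur's lemma applies. The empty word and the words of length 1 give its two hypotheses.
\<close>

lemma twisted_map_form:
  assumes deg: "\<And>n. f ` FK_degree n \<subseteq> FK_degree n"
    and eq: "\<And>y X. y \<in> carrier SM \<Longrightarrow> X \<in> carrier FK \<Longrightarrow> f (act y X) = act (S'_\<Gamma> \<alpha> i g y) (f X)"
  shows "\<exists>\<kappa>. \<forall>n A. f (homog n A) = homog n (twist i j \<kappa> g n A)"
proof -
  have "\<exists>B. f (homog n A) = homog n B" for n A
    using deg[of n] unfolding FK_degree_eq by blast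
  then obtain T where T: "\<And>n A. f (homog n A) = homog n (T n A)"
    by metis
  have word: "T (length (letters w) + n) (word_mat \<rho> w ** A ** transpose m) =
      mscale (word_sign g w) (word_mat \<rho> w ** T n A ** transpose (M2_\<Gamma> i g m))" for w n A m
    using eq[of "word_tensor w m" "homog n A"]
    by (simp add: FK_act_word act_\<Gamma>_word T homog_rules(1))
  have "\<exists>\<kappa>. \<forall>n. T n = twist i j \<kappa> g n"
  proof (rule twisted_schur[OF nz two ii])
    show "T n (A ** transpose m) = T n A ** transpose (M2_\<Gamma> i g m)" for n A m
    proof -
      have "word_sign g 0 = (1 :: 'k)" "letters 0 = []"
        by (simp_all add: word_sign_def zero_monomial_def)
      then show ?thesis
        using word[of 0 n A m] by simp
    qed
    show "T (Suc n) (\<rho> l ** A) = mscale (gen_sign g l) (\<rho> l ** T n A)" for n l A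
      using word[of "Mon [l]" n A "mat 1"]
      by (simp add: word_sign_def transpose_mat M2_\<Gamma>_def q_inverse[OF ii])
  qed
  then show ?thesis
    using T by metis
qed

text \<open>
  The structure of the character \<open>g \<mapsto> \<langle>h, g\<rangle>\<close>, as extensional functions.
\<close>

definition std_structure :: "idx \<Rightarrow> idx \<Rightarrow> 'k FKvec \<Rightarrow> 'k FKvec"
  where "std_structure h g = restrict (FK_coeffwise (twist i j (gen_sign h g) g)) (carrier FK)"

lemma klinear_std_structure: "klinear FK FK (std_structure h g)"
  by (rule klinear_cong[OF klinear_FK_coeffwise[OF klinear_twist] kspace_FK]) (simp add: std_structure_def)

lemma std_structure_homog: "std_structure h g (homog n A) = homog n (twist i j (gen_sign h g) g n A)"
  by (simp add: std_structure_def homog_rules FK_coeffwise_homog[OF klinear_twist])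

lemma std_structure_structure:
  assumes "X \<in> carrier FK"
  shows "std_structure h g (std_structure h g' X) = std_structure h (klein_mult g g') X"
  by (rule klinear_FK_eqI_homog[OF klinear_compose[OF klinear_std_structure klinear_std_structure] klinear_std_structure _ assms])
    (simp add: std_structure_homog twist_twist[OF ii] gen_sign_mult)

lemma std_structure_I0:
  assumes "X \<in> carrier FK"
  shows "std_structure h I0 X = X"
proof -
  have "klinear FK FK (\<lambda>X. X)"
    by (rule klinearI) simp_all
  from klinear_FK_eqI_homog[OF klinear_std_structure this _ assms] show ?thesis
    by (simp add: std_structure_homog)
qed

lemma std_structure_equivariant:
  assumes y: "y \<in> carrier SM" and X: "X \<in> carrier FK"
  shows "std_structure h g (act y X) = act (S'_\<Gamma> \<alpha> i g y) (std_structure h g X)"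
proof (rule klinear_S'_eqI[OF _ _ _ y])
  have gX: "std_structure h g X \<in> carrier FK"
    using klinearD(1)[OF klinear_std_structure X] .
  show "klinear SM FK (\<lambda>y. std_structure h g (act y X))"
    by (rule klinear_compose[OF klinear_FK_act_left[OF X] klinear_std_structure])
  show "klinear SM FK (\<lambda>y. act (S'_\<Gamma> \<alpha> i g y) (std_structure h g X))"
    by (rule klinear_compose[OF klinear_S'_\<Gamma> klinear_FK_act_left[OF gX]])
  fix w m
  have "S'_\<Gamma> \<alpha> i g (word_tensor w m) \<in> carrier SM"
    using klinearD(1)[OF klinear_S'_\<Gamma>] by blast
  then show "std_structure h g (act (word_tensor w m) X) = act (S'_\<Gamma> \<alpha> i g (word_tensor w m)) (std_structure h g X)"
    by (intro klinear_FK_eqI_homog[OF klinear_compose[OF klinear_FK_act_right klinear_std_structure]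
          klinear_compose[OF klinear_std_structure klinear_FK_act_right] _ X])
      (auto simp: FK_act_word act_\<Gamma>_word std_structure_homog twist_equivariant[OF nz ii])
qed

abbreviation structures :: "(idx \<Rightarrow> 'k FKvec \<Rightarrow> 'k FKvec) set"
  where "structures \<equiv> equivariant_structures \<Gamma> (S' \<alpha>) (S'_\<Gamma> \<alpha> i) FK act FK_degree"

lemma group_action_std_structure: "group_action \<Gamma> (carrier FK) (std_structure h)"
proof (intro group_action.intro group_hom.intro group_hom_axioms.intro group_\<Gamma> group_BijGroup homI)
  have closed: "std_structure h g X \<in> carrier FK" if "X \<in> carrier FK" for g X
    using klinearD(1)[OF klinear_std_structure that] .
  have inv: "std_structure h g (std_structure h g X) = X" if "X \<in> carrier FK" for g X
  proof -
    have "klein_mult g g = I0"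
      by (cases g) simp_all
    then show ?thesis
      using std_structure_structure[OF that] std_structure_I0[OF that] by simp
  qed
  have bij: "std_structure h g \<in> Bij (carrier FK)" for g
  proof -
    have "bij_betw (std_structure h g) (carrier FK) (carrier FK)"
      by (rule bij_betw_byWitness[where f' = "std_structure h g"]) (auto simp: inv closed)
    then show ?thesis
      by (simp add: Bij_def std_structure_def)
  qed
  fix g g'
  show "std_structure h g \<in> carrier (BijGroup (carrier FK))"
    using bij by (simp add: BijGroup_def)
  show "std_structure h (g \<otimes>\<^bsub>\<Gamma>\<^esub> g') = std_structure h g \<otimes>\<^bsub>BijGroup (carrier FK)\<^esub> std_structure h g'"
    using bij by (auto simp: BijGroup_def compose_def std_structure_structure std_structure_def[of h "klein_mult g g'"] fun_eq_iff)
qed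

lemma std_structure_mem: "std_structure h \<in> structures"
  using klinearD[OF klinear_std_structure]
  by (auto simp: equivariant_structures_def group_action_std_structure std_structure_equivariant
      FK_degree_eq std_structure_homog)

text \<open>
  The scalars of a given structure form a character because the maps for \<open>g\<close> and \<open>g'\<close> compose to the
  map for the product; comparing values at the identity matrix in degree 0 suffices.
\<close>

lemma structures_eq: "structures = range std_structure"
proof (intro equalityI subsetI)
  fix \<phi> assume \<phi>: "\<phi> \<in> structures"
  then interpret group_action \<Gamma> "carrier FK" \<phi>
    by (simp add: equivariant_structures_def)
  have add: "\<phi> g (X \<oplus>\<^bsub>FK\<^esub> Y) = \<phi> g X \<oplus>\<^bsub>FK\<^esub> \<phi> g Y"
    and smult: "\<phi> g (d \<odot>\<^bsub>FK\<^esub> X) = d \<odot>\<^bsub>FK\<^esub> \<phi> g X"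
    and deg: "\<phi> g ` FK_degree n \<subseteq> FK_degree n"
    and eq: "y \<in> carrier SM \<Longrightarrow> \<phi> g (act y X) = act (S'_\<Gamma> \<alpha> i g y) (\<phi> g X)"
    if "X \<in> carrier FK" "Y \<in> carrier FK" for g d X Y n y
    using \<phi> that by (simp_all add: equivariant_structures_def)
  have deg': "\<phi> g ` FK_degree n \<subseteq> FK_degree n" for g n
    using deg[OF FK.zero_closed FK.zero_closed] .
  have "\<exists>\<kappa>. \<forall>n A. \<phi> g (homog n A) = homog n (twist i j \<kappa> g n A)" for g
    by (rule twisted_map_form) (use deg' eq in auto)
  then obtain \<theta> where \<theta>: "\<And>g n A. \<phi> g (homog n A) = homog n (twist i j (\<theta> g) g n A)"
    by metis
  have "\<theta> (klein_mult g g') = \<theta> g * \<theta> g'" for g g'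
  proof -
    have "\<phi> (g \<otimes>\<^bsub>\<Gamma>\<^esub> g') (homog 0 (mat 1)) = \<phi> g (\<phi> g' (homog 0 (mat 1)))"
      by (rule composition_rule) (simp_all add: homog_rules)
    then have "twist i j (\<theta> (klein_mult g g')) (klein_mult g g') 0 (mat 1) =
        twist i j (\<theta> g * \<theta> g') (klein_mult g g') 0 (mat 1)"
      by (simp add: \<theta> twist_twist[OF ii])
    then show ?thesis
      by (rule twist_inject[OF ii])
  qed
  moreover have "\<theta> I0 = 1"
  proof -
    have "\<phi> I0 (homog 0 (mat 1)) = homog 0 (mat 1)"
      using id_eq_one by (simp add: homog_rules fun_eq_iff) (metis homog_rules(1))
    then have "twist i j (\<theta> I0) I0 0 (mat 1) = twist i j 1 I0 0 (mat 1)"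
      by (simp add: \<theta>)
    then show ?thesis
      by (rule twist_inject[OF ii])
  qed
  ultimately obtain h where h: "\<And>g. \<theta> g = gen_sign h g"
    using character_eq_gen_sign by metis
  have "\<phi> g = std_structure h g" for g
  proof (rule extensionalityI[of _ "carrier FK"])
    show "\<phi> g \<in> extensional (carrier FK)"
      using bij_prop0[of g] by (simp add: Bij_def)
    show "std_structure h g \<in> extensional (carrier FK)"
      by (simp add: std_structure_def)
    have "klinear FK FK (\<phi> g)"
      by (rule klinearI) (use add smult element_image[of g] in auto)
    then show "\<phi> g X = std_structure h g X" if "X \<in> carrier FK" for X
      by (rule klinear_FK_eqI_homog[OF _ klinear_std_structure _ that]) (simp add: \<theta> std_structure_homog h)
  qed
  then show "\<phi> \<in> range std_structure"
    by blast
qed (use std_structure_mem in auto)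

lemma S'_\<Gamma>_I0:
  assumes "y \<in> carrier SM"
  shows "S'_\<Gamma> \<alpha> i I0 y = y"
proof (rule klinear_S'_eqI[OF klinear_S'_\<Gamma> _ _ assms])
  interpret SM: kspace SM by (rule kspace_tensor_space)
  show "klinear SM SM (\<lambda>y. y)"
    by (rule klinearI) simp_all
  fix w m
  have "word_sign I0 w = (1 :: 'k)"
  proof -
    have "prod_list (map (gen_sign I0) ls) = (1 :: 'k)" for ls
      by (induction ls) simp_all
    then show ?thesis
      by (simp add: word_sign_def)
  qed
  moreover have "M2_\<Gamma> i I0 m = m"
    using q_inverse[OF ii, of I0] by (simp add: M2_\<Gamma>_def)
  ultimately show "S'_\<Gamma> \<alpha> i I0 (word_tensor w m) = word_tensor w m"
    unfolding S'_\<Gamma>_word by simp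
qed

text \<open>
  An isomorphism is a map twisted by the neutral element.
\<close>

lemma graded_module_iso_scalar:
  assumes f: "f \<in> graded_module_isos (S' \<alpha>) FK act FK_degree"
  obtains \<kappa> where "\<kappa> \<noteq> 0" and "\<And>n A. f (homog n A) = homog n (mscale \<kappa> A)"
proof -
  have "\<exists>\<kappa>. \<forall>n A. f (homog n A) = homog n (twist i j \<kappa> I0 n A)"
  proof (rule twisted_map_form)
    show "f ` FK_degree n \<subseteq> FK_degree n" for n
      using f by (simp add: graded_module_isos_def)
    show "f (act y X) = act (S'_\<Gamma> \<alpha> i I0 y) (f X)" if "y \<in> carrier SM" "X \<in> carrier FK" for y X
      using f that by (simp add: graded_module_isos_def S'_\<Gamma>_I0)
  qed
  then obtain \<kappa> where \<kappa>: "\<And>n A. f (homog n A) = homog n (mscale \<kappa> A)"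
    by (auto simp: twist_def transpose_mat)
  have "\<kappa> \<noteq> 0"
  proof
    assume "\<kappa> = 0"
    then have "f (homog 0 (mat 1)) = f (homog 0 0)"
      unfolding \<kappa> by simp
    moreover have "inj_on f (carrier FK)"
      using f by (simp add: graded_module_isos_def bij_betw_def)
    ultimately have "homog 0 (mat 1 :: 'k^2^2) = homog 0 0"
      using homog_rules(1) by (metis inj_onD)
    then show False
      by (simp add: mat2_eq_iff del: homog_zero)
  qed
  then show ?thesis
    using \<kappa> that by blast
qed

lemma twist_mscale: "twist i j \<mu> g n (mscale \<kappa> A) = mscale \<kappa> (twist i j \<mu> g n A)"
  by (simp add: twist_def mscale_mult mult_ac)

text \<open>
  A scalar isomorphism commutes with every structure, so the two structures have the same character.
\<close>

lemma structure_iso_imp_eq: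
  assumes f: "f \<in> graded_module_isos (S' \<alpha>) FK act FK_degree"
    and eq: "\<And>g X. X \<in> carrier FK \<Longrightarrow> f (std_structure h g X) = std_structure h' g (f X)"
  shows "h = h'"
proof (rule gen_sign_inject[OF two])
  fix g
  obtain \<kappa> where \<kappa>: "\<kappa> \<noteq> 0" "\<And>n A. f (homog n A) = homog n (mscale \<kappa> A)"
    using graded_module_iso_scalar[OF f] by blast
  have "mscale \<kappa> (twist i j (gen_sign h g) g 0 (mat 1)) = mscale \<kappa> (twist i j (gen_sign h' g) g 0 (mat 1))"
    using eq[of "homog 0 (mat 1)" g] by (simp add: homog_rules(1) std_structure_homog \<kappa>(2) twist_mscale)
  then have "mscale (1 / \<kappa>) (mscale \<kappa> (twist i j (gen_sign h g) g 0 (mat 1))) =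
      mscale (1 / \<kappa>) (mscale \<kappa> (twist i j (gen_sign h' g) g 0 (mat 1)))"
    by simp
  then have "twist i j (gen_sign h g) g 0 (mat 1) = twist i j (gen_sign h' g) g 0 (mat 1)"
    using \<kappa>(1) by simp
  then show "gen_sign h g = (gen_sign h' g :: 'k)"
    by (rule twist_inject[OF ii])
qed

lemma id_graded_module_iso: "(\<lambda>X. X) \<in> graded_module_isos (S' \<alpha>) FK act FK_degree"
  by (auto simp: graded_module_isos_def bij_betw_def)

lemma inj_std_structure: "inj std_structure"
  by (rule injI) (rule structure_iso_imp_eq[OF id_graded_module_iso], simp)

lemma equivariant_iso_eq_Id_on:
  "equivariant_iso \<Gamma> (S' \<alpha>) (S'_\<Gamma> \<alpha> i) FK act FK_degree = Id_on structures"
proof (intro equalityI subsetI)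
  fix z assume "z \<in> equivariant_iso \<Gamma> (S' \<alpha>) (S'_\<Gamma> \<alpha> i) FK act FK_degree"
  then obtain h h' f where z: "z = (std_structure h, std_structure h')"
    and f: "f \<in> graded_module_isos (S' \<alpha>) FK act FK_degree"
      "\<And>g X. X \<in> carrier FK \<Longrightarrow> f (std_structure h g X) = std_structure h' g (f X)"
    by (auto simp: equivariant_iso_def structures_eq)
  have "h = h'"
    using structure_iso_imp_eq[OF f] .
  then show "z \<in> Id_on structures"
    using std_structure_mem by (simp add: z Id_on_iff)
next
  fix z assume "z \<in> Id_on structures"
  then show "z \<in> equivariant_iso \<Gamma> (S' \<alpha>) (S'_\<Gamma> \<alpha> i) FK act FK_degree"
    using id_graded_module_iso by (auto simp: equivariant_iso_def)
qed

lemma card_structure_classes: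
  "card (structures // equivariant_iso \<Gamma> (S' \<alpha>) (S'_\<Gamma> \<alpha> i) FK act FK_degree) = 4"
proof -
  have "structures // Id_on structures = (\<lambda>\<phi>. {\<phi>}) ` structures"
    by (auto simp: quotient_def Id_on_def)
  also have "card \<dots> = card structures"
    by (rule card_image) simp
  also have "\<dots> = card (UNIV :: idx set)"
    unfolding structures_eq by (rule card_image[OF inj_std_structure])
  also have "(UNIV :: idx set) = {I0, I1, I2, I3}"
    using idx.exhaust by blast
  finally show ?thesis
    by (simp add: equivariant_iso_eq_Id_on)
qed

end

theorem proposition4p3:
  fixes \<alpha> :: "idx \<Rightarrow> 'k::alg_closed_field" and a b c i :: 'k and j :: idx
  assumes "CHAR('k) \<noteq> 2" and "CHAR('k) \<noteq> 3"
    and "\<forall>l\<in>{I1, I2, I3}. \<alpha> l \<notin> {0, 1, - 1}"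
    and "\<alpha> I1 + \<alpha> I2 + \<alpha> I3 + \<alpha> I1 * \<alpha> I2 * \<alpha> I3 = 0"
    and "a^2 = \<alpha> I1" and "b^2 = \<alpha> I2" and "c^2 = \<alpha> I3" and "i^2 = - 1"
  shows "card (equivariant_structures \<Gamma> (S' \<alpha>) (S'_\<Gamma> \<alpha> i) FK (FK_act \<alpha> (V_gen a b c i j)) FK_degree
            // equivariant_iso \<Gamma> (S' \<alpha>) (S'_\<Gamma> \<alpha> i) FK (FK_act \<alpha> (V_gen a b c i j)) FK_degree) = 4"
proof -
  have "(2 :: 'k) \<noteq> 0"
  proof
    assume "(2 :: 'k) = 0"
    then have "CHAR('k) dvd 2"
      using of_nat_eq_0_iff_char_dvd[of 2, where ?'a = 'k] by simp
    then have "CHAR('k) = 1 \<or> CHAR('k) = 2"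
      using two_is_prime_nat prime_nat_iff by blast
    then show False
      using assms(1) CHAR_not_1' by auto
  qed
  then interpret equivariant_setting \<alpha> a b c i j
    using assms by unfold_locales (auto simp: power2_eq_square)
  show ?thesis
    by (rule card_structure_classes)
qed

end
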